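(* Let $A\in\mathbb M_{N\times N}$ and $B=(b_1,\dots,b_M)\in\mathbb M_{N\times M}$, $1\le M\le N$, satisfy $\mathrm{rank}[b_i,Ab_i,\dots,A^{N-1}b_i]=N$ for every $i=1,\dots,M$. Then the minimum time function $T$ to reach the origin for the system $\dot x=Ax+Bu$, $u\in[-1,1]^M$, satisfies $T\in SBV_{\mathrm{loc}}(\mathbb R^N)$.
   Context: $T(x)$ is the infimum of times $\theta\ge0$ such that some measurable control with values in $[-1,1]^M$ steers $x$ to $0$ in time $\theta$. $SBV_{\mathrm{loc}}(\mathbb R^N)$ denotes the functions of locally bounded variation whose distributional derivative has vanishing Cantor part.
   Formalization: T may be +∞ outside the reachable set R = {T < ∞} (e.g. N = M = 1, A = B = 1, where R = (−1,1)), so T need not be in L^1_loc(R^N); the claim proved is T ∈ SBV_loc(R), which is SBV_loc(R^N) whenever R = R^N. *)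

theory Defs
  imports "HOL-Analysis.Analysis"
begin

text \<open>Control system x' = A x + B u, u(t) in [-1,1]^M.  The control u is Lebesgue
measurable on [0,theta]; the trajectory is the Caratheodory solution, given in integral form.\<close>

definition steers_to_zero ::
  "real^'n^'n \<Rightarrow> real^'m^'n \<Rightarrow> real^'n \<Rightarrow> real \<Rightarrow> bool" where
  "steers_to_zero A B x0 \<theta> \<longleftrightarrow>
     (\<exists>(u :: real \<Rightarrow> real^'m) (x :: real \<Rightarrow> real^'n).
        u \<in> borel_measurable (lebesgue_on {0..\<theta>}) \<and>
        (\<forall>t\<in>{0..\<theta>}. \<forall>i. \<bar>u t $ i\<bar> \<le> 1) \<and>
        (\<lambda>s. A *v x s + B *v u s) integrable_on {0..\<theta>} \<and>
        (\<forall>t\<in>{0..\<theta>}. x t = x0 + integral {0..t} (\<lambda>s. A *v x s + B *v u s)) \<and>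
        x \<theta> = 0)"

text \<open>Minimum time function (value \<infinity> if the origin cannot be reached).\<close>
definition min_time :: "real^'n^'n \<Rightarrow> real^'m^'n \<Rightarrow> real^'n \<Rightarrow> ereal" where
  "min_time A B x0 = Inf {ereal \<theta> | \<theta>. \<theta> \<ge> 0 \<and> steers_to_zero A B x0 \<theta>}"

definition divergence :: "('a::euclidean_space \<Rightarrow> ('a \<Rightarrow>\<^sub>L 'a)) \<Rightarrow> 'a \<Rightarrow> real" where
  "divergence D x = (\<Sum>i\<in>Basis. blinfun_apply (D x) i \<bullet> i)"

definition C1c_field :: "'a::euclidean_space set \<Rightarrow> ('a \<Rightarrow> 'a) \<Rightarrow> ('a \<Rightarrow> ('a \<Rightarrow>\<^sub>L 'a)) \<Rightarrow> bool" where
  "C1c_field \<Omega> \<phi> D \<longleftrightarrow>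
     (\<forall>x. (\<phi> has_derivative blinfun_apply (D x)) (at x)) \<and> continuous_on UNIV D \<and>
     compact (closure {x. \<phi> x \<noteq> 0}) \<and> closure {x. \<phi> x \<noteq> 0} \<subseteq> \<Omega>"

text \<open>Approximate discontinuity set S_u (Ambrosio-Fusco-Pallara, Def. 3.63).\<close>
definition approx_disc_set :: "'a::euclidean_space set \<Rightarrow> ('a \<Rightarrow> real) \<Rightarrow> 'a set" where
  "approx_disc_set \<Omega> f = {x\<in>\<Omega>. \<not> (\<exists>z.
      ((\<lambda>r. (LINT y|lebesgue. indicator (ball x r) y * \<bar>f y - z\<bar>) / measure lebesgue (ball x r))
        \<longlongrightarrow> 0) (at_right 0))}"

text \<open>SBV_loc(Omega): f is L^1_loc, its distributional gradient is a (locally finite)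
R^N-valued Radon measure Df = nu |Df| (polar decomposition, |nu| = 1 |Df|-a.e.), and the
Cantor part D^c f = D^s f restricted to (Omega - S_f) vanishes, i.e. |Df| restricted to
Omega - S_f has no part singular w.r.t. Lebesgue measure.\<close>
definition SBV_loc :: "'a::euclidean_space set \<Rightarrow> ('a \<Rightarrow> real) \<Rightarrow> bool" where
  "SBV_loc \<Omega> f \<longleftrightarrow>
     (\<forall>K. compact K \<and> K \<subseteq> \<Omega> \<longrightarrow> f absolutely_integrable_on K) \<and>
     (\<exists>(\<mu> :: 'a measure) (\<nu> :: 'a \<Rightarrow> 'a).
        sets \<mu> = sets borel \<and> emeasure \<mu> (UNIV - \<Omega>) = 0 \<and>
        (\<forall>K. compact K \<and> K \<subseteq> \<Omega> \<longrightarrow> emeasure \<mu> K < \<infinity>) \<and>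
        \<nu> \<in> borel_measurable borel \<and> (AE x in \<mu>. norm (\<nu> x) = 1) \<and>
        (\<forall>\<phi> D. C1c_field \<Omega> \<phi> D \<longrightarrow>
            (LINT x|lebesgue. f x * divergence D x) = - (LINT x|\<mu>. \<phi> x \<bullet> \<nu> x)) \<and>
        (\<forall>E\<in>sets borel. E \<subseteq> \<Omega> - approx_disc_set \<Omega> f \<and> emeasure lebesgue E = 0
            \<longrightarrow> emeasure \<mu> E = 0))"

end

theory Submission
  imports Defs
begin

text \<open>
  The minimum time function \<open>T\<close> is continuous on its domain, so its approximate discontinuity set is
  empty there and the claim amounts to local \<open>W\<^sup>1\<^sup>,\<^sup>1\<close> regularity. The sublevel sets of \<open>T\<close> are
  convex, bounded, and strictly convex because every column of \<open>B\<close> is normal. By the layer cake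
  formula the derivative of \<open>T\<close> in a unit direction \<open>e\<close> is the difference of two positive measures, the
  images of Lebesgue measure under the maps sending a level \<open>t\<close> and a line parallel to \<open>\<plusminus>e\<close> to the point
  where the line leaves \<open>{T < t}\<close>. Such an image is absolutely continuous: at an exit point through
  which the line in direction \<open>exp (- t A) b\<close> (\<open>b\<close> a column of \<open>B\<close>) enters \<open>{T < t}\<close>, the exit parameter grows at
  a positive rate in \<open>t\<close>, so the parametrisation has a locally Lipschitz inverse there; the remaining
  exit points are negligible for each \<open>t\<close>, since by strict convexity each line parallel to
  \<open>exp (- t A) b\<close> carries at most one of them.
\<close>

section \<open>Exit points of convex sublevel sets\<close>

text \<open>\<open>T\<close> need not be locally Lipschitz: for the double integrator it grows like
  a square root along the position axis at the origin, so no local bound on the gradient is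
  available. The argument therefore takes place in the space of pairs (level, base point of a line),
  with Lebesgue measure as reference. A null set of pairs carries no mass, so nothing has to be
  estimated at the exit points where the Lipschitz estimate fails. The dynamics enter through two
  properties of the boundary of \<open>{T < t}\<close>: strict convexity and an expansion estimate.
  The latter explains the direction \<open>exp (- t A) b\<close>: extending the horizon from
  \<open>t\<close> to \<open>t + h\<close> enlarges the attainable set by short segments along
  \<open>exp (- s A) b\<close> and its negative, with \<open>s\<close> between \<open>t\<close> and
  \<open>t + h\<close>. At a boundary point from which this direction leads inside, convexity turns
  the enlargement into a ball of radius proportional to \<open>h\<close>. Strict convexity comes
  from normality: every switching function has countably many zeros, so the support function is
  differentiable off the origin.\<close>

locale convex_sublevels =
  fixes T :: "'a::euclidean_space \<Rightarrow> ereal"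
  assumes continuous_T: "continuous_on UNIV T"
    and T_nonneg: "0 \<le> T x"
    and convex_sublevel: "convex {x. T x < ereal t}"
    and bounded_sublevel: "bounded {x. T x < ereal t}"
begin

definition chord :: "'a \<Rightarrow> real \<Rightarrow> 'a \<Rightarrow> real set" where
  "chord e t x = {s. T (x + s *\<^sub>R e) < ereal t}"

text \<open>The value 0 on lines that miss the sublevel set is a convention; \<open>window\<close>
  discards those lines.\<close>

definition exit :: "'a \<Rightarrow> real \<Rightarrow> 'a \<Rightarrow> real" where
  "exit e t x = (if chord e t x = {} then 0 else Sup (chord e t x))"

definition exit_pt :: "'a \<Rightarrow> real \<Rightarrow> 'a \<Rightarrow> 'a" where
  "exit_pt e t x = x + exit e t x *\<^sub>R e"

lemma continuous_on_T_compose [continuous_intros]: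
  "continuous_on S f \<Longrightarrow> continuous_on S (\<lambda>z. T (f z))"
  by (rule continuous_on_compose2[OF continuous_T]) auto

lemma measurable_T [measurable]: "T \<in> borel_measurable borel"
  by (intro borel_measurable_continuous_onI continuous_T)

lemma open_sublevel: "open {x. T x < ereal t}"
  by (intro open_Collect_less continuous_intros)

lemma open_chord: "open (chord e t x)"
  unfolding chord_def by (intro open_Collect_less continuous_intros)

lemma convex_chord: "convex (chord e t x)"
proof -
  have "chord e t x = (\<lambda>s. x + s *\<^sub>R e) -` {x. T x < ereal t}"
    by (auto simp: chord_def)
  moreover have "(\<lambda>s::real. x + s *\<^sub>R e) -` {x. T x < ereal t}
      = (\<lambda>s. s *\<^sub>R e) -` ((\<lambda>y. - x + y) ` {x. T x < ereal t})"
    by (auto simp: image_iff) (metis add.commute add_diff_cancel_left' uminus_add_conv_diff)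
  moreover have "linear (\<lambda>s::real. s *\<^sub>R e)" by (simp add: linear_iff scaleR_left_distrib)
  ultimately show ?thesis
    by (metis convex_linear_vimage convex_translation convex_sublevel)
qed

lemma bounded_chord: assumes "norm e = 1" shows "bounded (chord e t x)"
proof -
  obtain r where r: "\<And>y. T y < ereal t \<Longrightarrow> norm y \<le> r"
    using bounded_sublevel[of t] unfolding bounded_iff by auto
  have "norm s \<le> r + norm x" if "s \<in> chord e t x" for s
  proof -
    have "\<bar>s\<bar> = norm ((x + s *\<^sub>R e) - x)" using assms by simp
    also have "\<dots> \<le> r + norm x"
      using r[of "x + s *\<^sub>R e"] that norm_triangle_ineq4[of "x + s *\<^sub>R e" x] by (simp add: chord_def)
    finally show ?thesis by simp
  qed
  then show ?thesis unfolding bounded_iff by blast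
qed

lemma less_exit_iff:
  assumes "norm e = 1" "chord e t x \<noteq> {}"
  shows "c < exit e t x \<longleftrightarrow> (\<exists>s\<in>chord e t x. c < s)"
  using assms bounded_chord[OF assms(1), THEN bounded_imp_bdd_above]
  by (simp add: exit_def less_cSup_iff)

lemma exit_notin_chord:
  assumes "norm e = 1"
  shows "chord e t x \<noteq> {} \<Longrightarrow> exit e t x \<notin> chord e t x"
proof
  assume ne: "chord e t x \<noteq> {}" and i: "exit e t x \<in> chord e t x"
  obtain d where "d > 0" and d: "\<And>y. dist y (exit e t x) < d \<Longrightarrow> y \<in> chord e t x"
    using open_chord[of e t x] i unfolding open_dist by blast
  have "exit e t x + d/2 \<in> chord e t x" using \<open>d > 0\<close> by (intro d) (simp add: dist_real_def)
  moreover have "exit e t x < exit e t x + d/2" using \<open>d > 0\<close> by simp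
  ultimately show False using less_exit_iff[OF assms ne, of "exit e t x"] by blast
qed

lemma less_exit: 
  assumes "norm e = 1" "s \<in> chord e t x"
  shows "s < exit e t x"
proof -
  have ne: "chord e t x \<noteq> {}" using assms by auto
  have "\<not> exit e t x < s" using less_exit_iff[OF assms(1) ne, of "exit e t x"] assms(2) by auto
  moreover have "s \<noteq> exit e t x" using exit_notin_chord[OF assms(1) ne] assms(2) by auto
  ultimately show ?thesis by simp
qed

lemma chord_uminus: "s \<in> chord (- e) t x \<longleftrightarrow> - s \<in> chord e t x"
  by (simp add: chord_def)

lemma chord_uminus_eq_empty: "chord (- e) t x = {} \<longleftrightarrow> chord e t x = {}"
  using chord_uminus[of _ e t x] by (metis (full_types) equals0I add.inverse_inverse ex_in_conv)

text \<open>The lower end of a chord is minus the exit parameter in direction \<open>- e\<close>, so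
  entry points never need a theory of their own.\<close>

lemma chord_eq:
  assumes "norm e = 1" "chord e t x \<noteq> {}"
  shows "chord e t x = {- exit (- e) t x <..< exit e t x}"
proof (intro set_eqI iffI)
  fix s assume s: "s \<in> chord e t x"
  have "- s < exit (- e) t x" using s assms(1) by (intro less_exit) (auto simp: chord_uminus)
  with less_exit[OF assms(1) s] show "s \<in> {- exit (- e) t x <..< exit e t x}" by auto
next
  fix s assume "s \<in> {- exit (- e) t x <..< exit e t x}"
  then have "s < exit e t x" "- s < exit (- e) t x" by auto
  then obtain s1 s2 where s: "s1 \<in> chord e t x" "s < s1" "s2 \<in> chord (- e) t x" "- s < s2"
    using less_exit_iff[of e t x s] less_exit_iff[of "- e" t x "- s"] assms chord_uminus_eq_empty[of e t x]
    by auto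
  have i: "is_interval (chord e t x)" using convex_chord by (simp add: is_interval_convex_1)
  have "- s2 \<in> chord e t x" using s(3) by (simp add: chord_uminus)
  then show "s \<in> chord e t x" using mem_is_interval_1_I[OF i, of "- s2" s1 s] s by simp
qed

lemma exit_pt_mem_closure:
  assumes "norm e = 1" "chord e t x \<noteq> {}"
  shows "exit_pt e t x \<in> closure {y. T y < ereal t}"
proof -
  have "exit e t x \<in> closure (chord e t x)"
    unfolding exit_def using assms bounded_chord[OF assms(1), of t x]
    by (auto intro!: closure_contains_Sup bounded_imp_bdd_above)
  then have "(\<lambda>s. x + s *\<^sub>R e) (exit e t x) \<in> closure ((\<lambda>s. x + s *\<^sub>R e) ` chord e t x)"
    by (rule image_closure_subset[THEN subsetD, rotated 3, OF imageI])
       (auto intro!: continuous_intros closure_subset[THEN subsetD])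
  also have "\<dots> \<subseteq> closure {y. T y < ereal t}" by (rule closure_mono) (auto simp: chord_def)
  finally show ?thesis by (simp add: exit_pt_def)
qed

text \<open>An open chord omits its supremum, which gives one inequality; continuity gives the
  other. The level of a pair can thus be read off from its exit point.\<close>

lemma T_exit_pt:
  assumes "norm e = 1" "chord e t x \<noteq> {}"
  shows "T (exit_pt e t x) = ereal t"
proof (rule antisym)
  have "closed {y. T y \<le> ereal t}" by (intro closed_Collect_le continuous_intros)
  then have "closure {y. T y < ereal t} \<subseteq> {y. T y \<le> ereal t}" by (intro closure_minimal) auto
  then show "T (exit_pt e t x) \<le> ereal t" using exit_pt_mem_closure[OF assms] by auto
  show "ereal t \<le> T (exit_pt e t x)"
    using exit_notin_chord[OF assms] by (simp add: exit_pt_def chord_def)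
qed

definition lines_through :: "'a \<Rightarrow> (real \<times> 'a) set" where
  "lines_through e = {(t, x). chord e t x \<noteq> {}}"

lemma open_lines_through_above:
  "open {z::real \<times> 'a. \<exists>s\<in>chord e (fst z) (snd z). c < s}" (is "open ?S")
proof -
  have "?S = (\<Union>s\<in>{c<..}. {z. T (snd z + s *\<^sub>R e) < ereal (fst z)})"
    by (auto simp: chord_def)
  moreover have "open {z::real \<times> 'a. T (snd z + s *\<^sub>R e) < ereal (fst z)}" for s
    by (intro open_Collect_less continuous_intros)
  ultimately show ?thesis by auto
qed

lemma open_lines_through: "open (lines_through e)"
proof -
  have "lines_through e = (\<Union>s. {z. T (snd z + s *\<^sub>R e) < ereal (fst z)})"
    by (auto simp: chord_def lines_through_def)
  moreover have "open {z::real \<times> 'a. T (snd z + s *\<^sub>R e) < ereal (fst z)}" for s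
    by (intro open_Collect_less continuous_intros)
  ultimately show ?thesis by auto
qed

lemma borel_lines_through [measurable]: "lines_through e \<in> sets borel"
  using open_lines_through by auto

lemma measurable_exit [measurable]:
  assumes "norm e = 1"
  shows "(\<lambda>z. exit e (fst z) (snd z)) \<in> borel_measurable borel"
proof (rule borel_measurable_iff_greater[THEN iffD2], intro allI)
  fix c
  let ?S = "{z. \<exists>s\<in>chord e (fst z) (snd z). c < s}"
  have S: "?S \<in> sets borel" by (rule borel_open[OF open_lines_through_above])
  \<comment> \<open>Missed lines have the conventional exit value 0, hence belong to the set exactly
    when \<open>c < 0\<close>.\<close>
  have "{z \<in> space borel. c < exit e (fst z) (snd z)} = 
    (if c < 0 then ?S \<union> - lines_through e else ?S)"
    using less_exit_iff[OF assms]
    by (auto simp: lines_through_def exit_def split: if_splits)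
  also have "\<dots> \<in> sets borel" using S by auto
  finally show "{z \<in> space borel. c < exit e (fst z) (snd z)} \<in> sets borel" .
qed

lemma measurable_exit_pt [measurable]:
  assumes "norm e = 1"
  shows "(\<lambda>z. exit_pt e (fst z) (snd z)) \<in> borel_measurable borel"
proof -
  note [measurable] = measurable_exit[OF assms]
  have [measurable]: "fst \<in> borel_measurable borel" "snd \<in> borel_measurable borel"
    by (auto intro!: borel_measurable_continuous_onI continuous_intros)
  show ?thesis unfolding exit_pt_def by measurable
qed

text \<open>The window has length one and slides with the base point of the line, so every exit point is
  counted with total weight one. It is half-open so that the windows for \<open>e\<close> and \<open>- e\<close> balance exactly
  in the integration by parts below.\<close>

definition window :: "'a \<Rightarrow> (real \<times> 'a) set" where
  "window e = {z \<in> lines_through e. - 1/2 < exit e (fst z) (snd z) \<and> exit e (fst z) (snd z) \<le> 1/2}"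

lemma borel_window [measurable]: assumes "norm e = 1" shows "window e \<in> sets borel"
proof -
  note [measurable] = measurable_exit[OF assms]
  have "{z \<in> space borel. z \<in> lines_through e \<and> - 1/2 < exit e (fst z) (snd z) \<and> exit e (fst z) (snd z) \<le> 1/2} \<in> sets borel"
    by measurable
  then show ?thesis by (simp add: window_def)
qed

text \<open>Geometrically this is the positive part of \<open>n \<bullet> e\<close> times surface
  measure on the boundary of \<open>{T < t}\<close>, integrated over \<open>t\<close>, where
  \<open>n\<close> is the outer unit normal.\<close>

definition flux :: "'a \<Rightarrow> 'a measure" where
  "flux e = distr (density lborel (indicator (window e))) borel (\<lambda>z. exit_pt e (fst z) (snd z))"

lemma sets_flux [simp, measurable_cong]: "sets (flux e) = sets borel"
  and space_flux [simp]: "space (flux e) = UNIV"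
  by (simp_all add: flux_def)

lemma emeasure_flux:
  assumes "norm e = 1" "E \<in> sets borel"
  shows "emeasure (flux e) E = emeasure lborel {z \<in> window e. exit_pt e (fst z) (snd z) \<in> E}"
proof -
  note [measurable] = measurable_exit_pt[OF assms(1)] borel_window[OF assms(1)] assms(2)
  have "{z. exit_pt e (fst z) (snd z) \<in> E} \<in> sets borel"
    using measurable_sets[OF measurable_exit_pt[OF assms(1)] assms(2)] by (simp add: vimage_def)
  then have "window e \<inter> {z. exit_pt e (fst z) (snd z) \<in> E} \<in> sets borel" by simp
  then show ?thesis unfolding flux_def
    by (simp add: emeasure_distr emeasure_density vimage_def Collect_conj_eq[symmetric] 
        indicator_inter_arith[symmetric] Int_def)
qed

end

section \<open>Absolute continuity of the exit measure\<close>

lemma nn_integral_lborel_translate: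
  fixes f :: "'a::euclidean_space \<Rightarrow> ennreal"
  assumes [measurable]: "f \<in> borel_measurable borel"
  shows "(\<integral>\<^sup>+x. f (x + c) \<partial>lborel) = (\<integral>\<^sup>+x. f x \<partial>lborel)"
proof -
  have "(\<integral>\<^sup>+x. f x \<partial>lborel) = (\<integral>\<^sup>+x. f x \<partial>distr lborel borel ((+) c))"
    by (simp add: lborel_distr_plus)
  also have "\<dots> = (\<integral>\<^sup>+x. f (x + c) \<partial>lborel)"
    by (subst nn_integral_distr) (auto simp: add.commute)
  finally show ?thesis ..
qed

text \<open>Averaging over unit segments parallel to \<open>e\<close> makes Fubini's theorem along \<open>e\<close>
  available without splitting off a coordinate.\<close>

lemma nn_integral_segments:
  fixes f :: "'a::euclidean_space \<Rightarrow> ennreal"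
  assumes [measurable]: "f \<in> borel_measurable borel"
  shows "(\<integral>\<^sup>+x. (\<integral>\<^sup>+s. indicator {-1/2..1/2} s * f (x + s *\<^sub>R e) \<partial>lborel) \<partial>lborel) = (\<integral>\<^sup>+x. f x \<partial>lborel)"
proof -
  have "(\<integral>\<^sup>+x. (\<integral>\<^sup>+s. indicator {-1/2..1/2::real} s * f (x + s *\<^sub>R e) \<partial>lborel) \<partial>lborel)
     = (\<integral>\<^sup>+s. (\<integral>\<^sup>+x. indicator {-1/2..1/2::real} s * f (x + s *\<^sub>R e) \<partial>lborel) \<partial>lborel)"
    by (rule lborel_pair.Fubini') measurable
  also have "\<dots> = (\<integral>\<^sup>+s. indicator {-1/2..1/2::real} s * (\<integral>\<^sup>+x. f x \<partial>lborel) \<partial>lborel)"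
    by (simp add: nn_integral_cmult nn_integral_lborel_translate)
  also have "\<dots> = (\<integral>\<^sup>+x. f x \<partial>lborel)"
    by (simp add: nn_integral_multc)
  finally show ?thesis .
qed

lemma null_sets_if_lines_null:
  fixes N :: "'a::euclidean_space set"
  assumes [measurable]: "N \<in> sets borel" and lines: "\<And>x. {s. x + s *\<^sub>R e \<in> N} \<in> null_sets lborel"
  shows "N \<in> null_sets lborel"
proof -
  have "(\<integral>\<^sup>+s. indicator {-1/2..1/2::real} s * indicator N (x + s *\<^sub>R e) \<partial>lborel) = (0::ennreal)" for x
  proof -
    have "AE s in lborel. s \<notin> {s. x + s *\<^sub>R e \<in> N}" by (rule AE_not_in[OF lines])
    then show ?thesis by (subst nn_integral_0_iff_AE) (auto elim!: eventually_mono)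
  qed
  then have "emeasure lborel N = 0"
    using nn_integral_segments[of "indicator N" e] by simp
  then show ?thesis by auto
qed

text \<open>Segments of length one are long enough here, because \<open>window\<close> confines the
  exit parameter to such an interval.\<close>

lemma AE_segments_null:
  fixes N :: "'a::euclidean_space set"
  assumes N: "N \<in> null_sets lborel"
  shows "AE x in lborel. {s\<in>{-1/2..1/2}. x + s *\<^sub>R e \<in> N} \<in> null_sets lborel"
proof -
  have [measurable]: "N \<in> sets borel" using N by auto
  have "(\<integral>\<^sup>+x. (\<integral>\<^sup>+s. indicator {-1/2..1/2} s * indicator N (x + s *\<^sub>R e) \<partial>lborel) \<partial>lborel) = (0::ennreal)"
    using N by (subst nn_integral_segments) auto
  then have "AE x in lborel. (\<integral>\<^sup>+s. indicator {-1/2..1/2} s * indicator N (x + s *\<^sub>R e) \<partial>lborel) = (0::ennreal)"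
    by (subst (asm) nn_integral_0_iff_AE) measurable
  then show ?thesis
  proof (rule eventually_mono)
    fix x assume z: "(\<integral>\<^sup>+s. indicator {-1/2..1/2} s * indicator N (x + s *\<^sub>R e) \<partial>lborel) = (0::ennreal)"
    let ?S = "{s\<in>{-1/2..1/2}. x + s *\<^sub>R e \<in> N}"
    have S: "?S \<in> sets lborel" by measurable
    have "emeasure lborel ?S = (\<integral>\<^sup>+s. indicator ?S s \<partial>lborel)" using S by simp
    also have "\<dots> = 0" by (subst z[symmetric], rule nn_integral_cong) (auto simp: indicator_def)
    finally show "?S \<in> null_sets lborel" using S by auto
  qed
qed

text \<open>Where \<open>g\<close> grows at a positive rate, its inverse is locally Lipschitz, so preimages of null
  sets are null there.\<close>

lemma negligible_preimage_of_growing: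
  fixes g :: "real \<Rightarrow> real"
  assumes growth: "\<And>t. t \<in> S \<Longrightarrow> \<exists>n::nat. \<forall>h. 0 < h \<and> h < 1 / real (Suc n) \<longrightarrow> g t + h / real (Suc n) \<le> g (t + h)"
    and null: "negligible (g ` S)"
  shows "negligible S"
proof -
  \<comment> \<open>\<open>n\<close> fixes the growth rate and the range of \<open>h\<close> in
    which it holds; \<open>k\<close> fixes a cell of length \<open>1 / (n + 1)\<close>, so that two
    points of one piece are always within that range.\<close>
  define D where "D n k = {t\<in>S. (\<forall>h. 0 < h \<and> h < 1 / real (Suc n) \<longrightarrow> g t + h / real (Suc n) \<le> g (t + h))
      \<and> \<lfloor>t * real (Suc n)\<rfloor> = k}" for n :: nat and k :: int
  have sub: "S \<subseteq> (\<Union>n. \<Union>k. D n k)" using growth unfolding D_def by fastforce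
  have "negligible (D n k)" for n k
  proof -
    have lip1: "t' - t \<le> real (Suc n) * (g t' - g t)" if "t \<in> D n k" "t' \<in> D n k" "t < t'" for t t'
    proof -
      have "\<lfloor>t * real (Suc n)\<rfloor> = \<lfloor>t' * real (Suc n)\<rfloor>" using that by (auto simp: D_def)
      then have "t' * real (Suc n) - t * real (Suc n) < 1" by linarith
      then have "(t' - t) < 1 / real (Suc n)" by (simp add: field_simps)
      then have "g t + (t' - t) / real (Suc n) \<le> g (t + (t' - t))"
        using that unfolding D_def by (metis (mono_tags, lifting) diff_gt_0_iff_gt mem_Collect_eq)
      then show ?thesis by (simp add: field_simps)
    qed
    have lip: "\<bar>t' - t\<bar> \<le> real (Suc n) * \<bar>g t' - g t\<bar>" if "t \<in> D n k" "t' \<in> D n k" for t t'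
    proof (cases t t' rule: linorder_cases)
      case less
      have "real (Suc n) * (g t' - g t) \<le> real (Suc n) * \<bar>g t' - g t\<bar>" by (intro mult_left_mono) auto
      with lip1[OF that less] less show ?thesis by linarith
    next
      case greater
      have "real (Suc n) * (g t - g t') \<le> real (Suc n) * \<bar>g t' - g t\<bar>" by (intro mult_left_mono) auto
      with lip1[OF that(2,1) greater] greater show ?thesis by linarith
    qed auto
    have inj: "inj_on g (D n k)" using lip by (intro inj_onI) fastforce
    define f where "f = inv_into (D n k) g"
    have f: "f (g t) = t" if "t \<in> D n k" for t unfolding f_def using inj that by simp
    have "D n k \<subseteq> S" by (auto simp: D_def)
    then have "negligible (g ` D n k)" using null by (meson image_mono negligible_subset)
    then have "negligible (f ` g ` D n k)"
    proof (rule negligible_locally_Lipschitz_image[rotated])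
      fix y assume "y \<in> g ` D n k"
      then show "\<exists>U B. open U \<and> y \<in> U \<and> (\<forall>z\<in>g ` D n k \<inter> U. norm (f z - f y) \<le> B * norm (z - y))"
        using lip by (intro exI[of _ UNIV] exI[of _ "real (Suc n)"]) (auto simp: f)
    qed simp
    moreover have "f ` g ` D n k = D n k" using f by (auto simp: image_iff)
    ultimately show ?thesis by simp
  qed
  then have "negligible (\<Union>n. \<Union>k\<in>UNIV. D n k)"
    by (intro negligible_countable_Union countable_image) auto
  then show ?thesis using sub by (rule negligible_subset)
qed

lemma null_sets_lborel_iff_negligible:
  fixes S :: "'a::euclidean_space set"
  assumes "S \<in> sets borel"
  shows "S \<in> null_sets lborel \<longleftrightarrow> negligible S"
  using assms by (simp add: negligible_iff_null_sets null_sets_completion_iff)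

text \<open>\<open>expanding\<close> is a one-sided Lipschitz bound at \<open>p\<close>: taking
  \<open>h = norm (q - p) / r\<close>, it says that \<open>T q\<close> exceeds \<open>t\<close> by
  at most \<open>norm (q - p) / r\<close> for \<open>q\<close> near \<open>p\<close> and different
  from it. The direction \<open>b\<close> varies with the level because the attainable set grows in
  a direction that moves with time.\<close>

locale expanding_sublevels = convex_sublevels +
  fixes b :: "real \<Rightarrow> 'a"
  assumes continuous_b: "continuous_on UNIV b"
    and b_nonzero: "b t \<noteq> 0"
    and strictly_convex: "T p = ereal t \<Longrightarrow> T q = ereal t \<Longrightarrow> p \<noteq> q \<Longrightarrow> T (midpoint p q) < ereal t"
    and expanding: "T p = ereal t \<Longrightarrow> T (p + d *\<^sub>R b t) < ereal t \<Longrightarrow>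
      \<exists>r>0. \<exists>h0>0. \<forall>h q. 0 < h \<and> h < h0 \<and> norm (q - p) \<le> r * h \<longrightarrow> T q \<le> ereal (t + h)"
begin

text \<open>Exit points at which some supporting hyperplane of the sublevel set is parallel to \<open>b\<close>; only
  there can the Lipschitz estimate for \<open>T\<close> fail.\<close>

definition shadow :: "'a \<Rightarrow> (real \<times> 'a) set" where
  "shadow e = {z \<in> lines_through e. \<forall>d. ereal (fst z) \<le> T (exit_pt e (fst z) (snd z) + d *\<^sub>R b (fst z))}"

text \<open>The quantifier over uncountably many \<open>d\<close> is harmless: the condition on the
  pair (level, exit point) is an intersection of closed conditions.\<close>

lemma borel_shadow:
  assumes "norm e = 1"
  shows "shadow e \<in> sets borel"
proof -
  note [measurable] = measurable_exit_pt[OF assms]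
  have [measurable]: "fst \<in> borel_measurable borel" "snd \<in> borel_measurable borel"
    by (auto intro!: borel_measurable_continuous_onI continuous_intros)
  define C where "C = (\<Inter>d. {z::real \<times> 'a. ereal (fst z) \<le> T (snd z + d *\<^sub>R b (fst z))})"
  have "closed C" unfolding C_def
    by (intro closed_INT ballI closed_Collect_le continuous_intros
        continuous_on_compose2[OF continuous_b]) auto
  then have C: "C \<in> sets borel" by auto
  have m: "(\<lambda>z. (fst z, exit_pt e (fst z) (snd z))) \<in> borel_measurable borel"
    by (subst borel_prod[symmetric]) measurable
  have "shadow e = lines_through e \<inter> (\<lambda>z. (fst z, exit_pt e (fst z) (snd z))) -` C"
    by (auto simp: shadow_def C_def)
  also have "\<dots> \<in> sets borel"
    using measurable_sets[OF m C] by auto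
  finally show ?thesis .
qed

text \<open>Join an interior point of the first chord to the exit point of the second line. All
  points of this segment except the far end are interior, and if the second exit is higher, the
  segment passes at the height of the first exit through a point that differs from the first exit
  point by a multiple of \<open>b t\<close>. This contradicts the first pair being in the
  shadow.\<close>

lemma shadow_not_exit_less:
  assumes e: "norm e = 1" and "(t, x) \<in> shadow e" "(t, x + \<sigma> *\<^sub>R b t) \<in> shadow e"
  shows "\<not> exit e t x < exit e t (x + \<sigma> *\<^sub>R b t)"
proof
  assume less: "exit e t x < exit e t (x + \<sigma> *\<^sub>R b t)"
  let ?U = "{y. T y < ereal t}" and ?p2 = "exit_pt e t (x + \<sigma> *\<^sub>R b t)"
  have ne: "chord e t x \<noteq> {}" "chord e t (x + \<sigma> *\<^sub>R b t) \<noteq> {}"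
    using assms by (auto simp: shadow_def lines_through_def)
  then obtain s where s: "s \<in> chord e t x" by auto
  have lt: "s < exit e t x" by (rule less_exit[OF e s])
  have q: "x + s *\<^sub>R e \<in> interior ?U" using s open_sublevel by (simp add: chord_def interior_open)
  \<comment> \<open>The fraction of the segment at which its \<open>e\<close>-parameter equals
    \<open>exit e t x\<close>.\<close>
  define l where "l = (exit e t x - s) / (exit e t (x + \<sigma> *\<^sub>R b t) - s)"
  have l: "0 < l" "l < 1" "l * (exit e t (x + \<sigma> *\<^sub>R b t) - s) = exit e t x - s"
    using lt less by (auto simp: l_def field_simps)
  have "?p2 - (1 - l) *\<^sub>R (?p2 - (x + s *\<^sub>R e)) \<in> interior ?U"
    using l by (intro mem_interior_closure_convex_shrink convex_sublevel q exit_pt_mem_closure e ne) auto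
  also have "?p2 - (1 - l) *\<^sub>R (?p2 - (x + s *\<^sub>R e))
      = x + s *\<^sub>R e + (l * \<sigma>) *\<^sub>R b t + (l * (exit e t (x + \<sigma> *\<^sub>R b t) - s)) *\<^sub>R e"
    by (simp add: exit_pt_def algebra_simps)
  also have "\<dots> = exit_pt e t x + (l * \<sigma>) *\<^sub>R b t"
    unfolding l(3) by (simp add: exit_pt_def algebra_simps)
  finally have "T (exit_pt e t x + (l * \<sigma>) *\<^sub>R b t) < ereal t"
    using interior_subset by fastforce
  then show False using assms(2) by (auto simp: shadow_def not_le[symmetric])
qed

text \<open>By symmetry both exit parameters agree, so the exit points differ by a multiple of
  \<open>b t\<close>. Their midpoint is interior by strict convexity and lies on the line along
  \<open>b t\<close> through the first exit point.\<close>

lemma shadow_section_unique: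
  assumes e: "norm e = 1" and 1: "(t, x) \<in> shadow e" and 2: "(t, x + \<sigma> *\<^sub>R b t) \<in> shadow e"
  shows "\<sigma> = 0"
proof (rule ccontr)
  assume \<sigma>: "\<sigma> \<noteq> 0"
  have ne: "chord e t x \<noteq> {}" "chord e t (x + \<sigma> *\<^sub>R b t) \<noteq> {}"
    using assms by (auto simp: shadow_def lines_through_def)
  have "\<not> exit e t (x + \<sigma> *\<^sub>R b t) < exit e t x"
    using shadow_not_exit_less[OF e 2, of "- \<sigma>"] 1 by simp
  then have eq: "exit e t (x + \<sigma> *\<^sub>R b t) = exit e t x"
    using shadow_not_exit_less[OF assms] by simp
  then have p2: "exit_pt e t (x + \<sigma> *\<^sub>R b t) = exit_pt e t x + \<sigma> *\<^sub>R b t"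
    by (simp add: exit_pt_def algebra_simps)
  have "T (midpoint (exit_pt e t x) (exit_pt e t x + \<sigma> *\<^sub>R b t)) < ereal t"
    using \<sigma> b_nonzero[of t] T_exit_pt[OF e ne(1)] T_exit_pt[OF e ne(2)]
    by (intro strictly_convex) (auto simp: p2)
  also have "midpoint (exit_pt e t x) (exit_pt e t x + \<sigma> *\<^sub>R b t) = exit_pt e t x + (\<sigma>/2) *\<^sub>R b t"
    by (simp add: midpoint_def algebra_simps flip: scaleR_2)
  finally show False using 1 by (auto simp: shadow_def not_le[symmetric])
qed

text \<open>Each time slice meets every line parallel to \<open>b t\<close> in at most one point, so
  it is null by Fubini along \<open>b t\<close>; Fubini in \<open>t\<close> finishes.\<close>

lemma null_shadow:
  assumes "norm e = 1"
  shows "shadow e \<in> null_sets lborel"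
proof -
  have b[measurable]: "shadow e \<in> sets borel" by (rule borel_shadow[OF assms])
  then have b': "shadow e \<in> sets (lborel \<Otimes>\<^sub>M lborel)" by (metis lborel_prod sets_lborel)
  have "Pair t -` shadow e \<in> null_sets lborel" for t
  proof (rule null_sets_if_lines_null)
    show "Pair t -` shadow e \<in> sets borel"
      using sets_Pair1[OF b'] by simp
    fix x
    have "\<exists>a. {s. x + s *\<^sub>R b t \<in> Pair t -` shadow e} \<subseteq> {a}"
    proof (cases "\<exists>a. (t, x + a *\<^sub>R b t) \<in> shadow e")
      case True
      then obtain a where a: "(t, x + a *\<^sub>R b t) \<in> shadow e" by blast
      have "s = a" if "(t, x + s *\<^sub>R b t) \<in> shadow e" for s
        using shadow_section_unique[OF assms a, of "s - a"] that by (simp add: algebra_simps)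
      then show ?thesis by auto
    qed auto
    then have "countable {s. x + s *\<^sub>R b t \<in> Pair t -` shadow e}"
      by (meson countable_finite finite.emptyI finite.insertI finite_subset)
    then show "{s. x + s *\<^sub>R b t \<in> Pair t -` shadow e} \<in> null_sets lborel"
      by (rule countable_imp_null_set_lborel)
  qed
  then have "emeasure lborel (Pair t -` shadow e) = 0" for t by blast
  then have "emeasure (lborel \<Otimes>\<^sub>M lborel) (shadow e) = 0"
    by (subst lborel.emeasure_pair_measure_alt[OF b']) simp
  then show ?thesis using b by (auto simp: lborel_prod)
qed

lemma exit_growth:
  assumes e: "norm e = 1" and z: "(t, x) \<in> lines_through e - shadow e"
  shows "\<exists>n::nat. \<forall>h. 0 < h \<and> h < 1 / real (Suc n) \<longrightarrow> exit e t x + h / real (Suc n) \<le> exit e (t + h) x"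
proof -
  have ne: "chord e t x \<noteq> {}" using z by (auto simp: lines_through_def)
  obtain d where d: "T (exit_pt e t x + d *\<^sub>R b t) < ereal t" 
    using z by (auto simp: shadow_def not_le)
  obtain r h0 where "r > 0" "h0 > 0" and
    ex: "\<And>h q. 0 < h \<Longrightarrow> h < h0 \<Longrightarrow> norm (q - exit_pt e t x) \<le> r * h \<Longrightarrow> T q \<le> ereal (t + h)"
    using expanding[OF T_exit_pt[OF e ne] d] by metis
  \<comment> \<open>One half of \<open>r\<close> pays for using the expansion bound at
    \<open>h/2\<close> below, which leaves room for the strict inequality in the definition of
    \<open>chord\<close>.\<close>
  obtain n where n: "1 / real (Suc n) < min (r/2) h0"
    using nat_approx_posE[of "min (r/2) h0"] \<open>r > 0\<close> \<open>h0 > 0\<close> by auto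
  show ?thesis
  proof (intro exI[of _ n] allI impI)
    fix h :: real assume h: "0 < h \<and> h < 1 / real (Suc n)"
    have "T (exit_pt e t x + (h / real (Suc n)) *\<^sub>R e) \<le> ereal (t + h/2)"
    proof (rule ex)
      have "h * (1 / real (Suc n)) \<le> h * (r/2)" using h n by (intro mult_left_mono) auto
      then show "norm (exit_pt e t x + (h / real (Suc n)) *\<^sub>R e - exit_pt e t x) \<le> r * (h/2)"
        using e h by (simp add: field_simps)
    qed (use h n in auto)
    also have "\<dots> < ereal (t + h)" using h by simp
    finally have "exit e t x + h / real (Suc n) \<in> chord e (t + h) x"
      by (simp add: chord_def exit_pt_def scaleR_left_distrib add.assoc)
    then show "exit e t x + h / real (Suc n) \<le> exit e (t + h) x"
      using less_exit[OF e] by (simp add: less_imp_le)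
  qed
qed

text \<open>Off the shadow, fix the line and vary the level: for almost every base point the line
  meets \<open>E\<close> in a null set of parameters, and growth of the exit parameter pulls this
  back to a null set of levels.\<close>

lemma absolutely_continuous_flux:
  assumes e: "norm e = 1"
  shows "absolutely_continuous lborel (flux e)"
  unfolding absolutely_continuous_def
proof
  fix E :: "'a set" assume E: "E \<in> null_sets lborel"
  then have [measurable]: "E \<in> sets borel" by auto
  note [measurable] = borel_window[OF e] measurable_exit_pt[OF e] borel_shadow[OF e]
  define M where "M = {z \<in> window e. exit_pt e (fst z) (snd z) \<in> E} - shadow e"
  have "{z \<in> space borel. z \<in> window e \<and> exit_pt e (fst z) (snd z) \<in> E \<and> z \<notin> shadow e} \<in> sets borel"
    by measurable
  then have M: "M \<in> sets borel" by (simp add: M_def set_diff_eq conj_assoc)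
  then have M': "M \<in> sets (lborel \<Otimes>\<^sub>M lborel)" by (metis lborel_prod sets_lborel)
  have "AE x in lborel. (\<lambda>t. (t, x)) -` M \<in> null_sets lborel"
    using AE_segments_null[OF E, of e]
  proof (rule eventually_mono)
    fix x assume x: "{s\<in>{-1/2..1/2}. x + s *\<^sub>R e \<in> E} \<in> null_sets lborel"
    have "(\<lambda>t. (t, x)) -` M \<in> sets borel" using sets_Pair2[OF M'] by simp
    moreover have "negligible ((\<lambda>t. (t, x)) -` M)"
    proof (rule negligible_preimage_of_growing)
      show "\<exists>n::nat. \<forall>h. 0 < h \<and> h < 1 / real (Suc n) \<longrightarrow> exit e t x + h / real (Suc n) \<le> exit e (t + h) x"
        if "t \<in> (\<lambda>t. (t, x)) -` M" for t
        using that by (intro exit_growth e) (auto simp: M_def window_def)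
      have "(\<lambda>t. exit e t x) ` ((\<lambda>t. (t, x)) -` M) \<subseteq> {s\<in>{-1/2..1/2}. x + s *\<^sub>R e \<in> E}"
        by (auto simp: M_def window_def exit_pt_def)
      moreover have "negligible {s\<in>{-1/2..1/2}. x + s *\<^sub>R e \<in> E}"
        using x null_sets_lborel_iff_negligible[of "{s\<in>{-1/2..1/2}. x + s *\<^sub>R e \<in> E}"]
        by (metis (no_types, lifting) null_setsD2 sets_lborel)
      ultimately show "negligible ((\<lambda>t. exit e t x) ` ((\<lambda>t. (t, x)) -` M))"
        by (rule negligible_subset[rotated])
    qed
    ultimately show "(\<lambda>t. (t, x)) -` M \<in> null_sets lborel"
      using null_sets_lborel_iff_negligible by blast
  qed
  then have "AE x in lborel. emeasure lborel ((\<lambda>t. (t, x)) -` M) = 0"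
    by (rule eventually_mono) auto
  then have "emeasure (lborel \<Otimes>\<^sub>M lborel) M = 0"
    by (subst lborel_pair.emeasure_pair_measure_alt2[OF M'], subst nn_integral_cong_AE[where v="\<lambda>_. 0"]) auto
  then have "M \<in> null_sets lborel" using M by (auto simp: lborel_prod)
  then have "M \<union> shadow e \<in> null_sets lborel" using null_shadow[OF e] by auto
  moreover have "{z \<in> window e. exit_pt e (fst z) (snd z) \<in> E} \<subseteq> M \<union> shadow e" by (auto simp: M_def)
  moreover have "{z \<in> space borel. z \<in> window e \<and> exit_pt e (fst z) (snd z) \<in> E} \<in> sets borel"
    by measurable
  ultimately have "emeasure lborel {z \<in> window e. exit_pt e (fst z) (snd z) \<in> E} = 0"
    using null_sets_subset[of "M \<union> shadow e" lborel "{z \<in> window e. exit_pt e (fst z) (snd z) \<in> E}"] by auto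
  then show "E \<in> null_sets (flux e)" by (auto simp: emeasure_flux[OF e])
qed

end

section \<open>The distributional derivative\<close>

lemma integrable_lborel_bounded_support:
  fixes f :: "'a::euclidean_space \<Rightarrow> real"
  assumes "f \<in> borel_measurable borel" "\<And>x. norm (f x) \<le> C" "\<And>x. f x \<noteq> 0 \<Longrightarrow> norm x \<le> r"
  shows "integrable lborel f"
proof (rule integrableI_bounded_set[where A="cball 0 r" and B=C])
  show "emeasure lborel (cball (0::'a) r) < \<infinity>" using emeasure_bounded_finite[OF bounded_cball] .
qed (use assms in \<open>auto intro!: AE_I2\<close>)

lemma integral_lborel_translate:
  fixes f :: "'a::euclidean_space \<Rightarrow> real"
  assumes [measurable]: "f \<in> borel_measurable borel"
  shows "(\<integral>x. f (x + c) \<partial>lborel) = (\<integral>x. f x \<partial>lborel)"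
proof -
  have "(\<integral>x. f x \<partial>lborel) = (\<integral>x. f x \<partial>distr lborel borel ((+) c))"
    by (simp add: lborel_distr_plus)
  also have "\<dots> = (\<integral>x. f (x + c) \<partial>lborel)"
    by (subst integral_distr) (auto simp: add.commute)
  finally show ?thesis ..
qed

lemma integral_segments:
  fixes f :: "'a::euclidean_space \<Rightarrow> real"
  assumes [measurable]: "f \<in> borel_measurable borel" and C: "\<And>x. \<bar>f x\<bar> \<le> C" 
    and r: "\<And>x. f x \<noteq> 0 \<Longrightarrow> norm x \<le> r"
  shows "(\<integral>x. (\<integral>s. indicator {-1/2..1/2} s * f (x + s *\<^sub>R e) \<partial>lborel) \<partial>lborel) = (\<integral>x. f x \<partial>lborel)"
proof -
  let ?F = "\<lambda>s x. indicator {-1/2..1/2::real} s * f (x + s *\<^sub>R e)"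
  have "case_prod ?F \<in> borel_measurable (borel \<Otimes>\<^sub>M borel)" by measurable
  then have m: "case_prod ?F \<in> borel_measurable borel" by (simp add: borel_prod)
  have "integrable lborel (case_prod ?F)"
  proof (rule integrable_lborel_bounded_support[OF m, of C "1 + (r + norm e)"])
    fix z :: "real \<times> 'a"
    show "norm (case_prod ?F z) \<le> C"
      using C[of "snd z + fst z *\<^sub>R e"] by (auto simp: indicator_def abs_mult split_beta)
    assume "case_prod ?F z \<noteq> 0"
    then have z: "\<bar>fst z\<bar> \<le> 1" "norm (snd z + fst z *\<^sub>R e) \<le> r"
      using r[of "snd z + fst z *\<^sub>R e"] by (auto simp: indicator_def split_beta split: if_splits)
    have "norm (snd z) \<le> norm (snd z + fst z *\<^sub>R e) + norm (fst z *\<^sub>R e)"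
      by (metis add_diff_cancel_right' norm_triangle_ineq4)
    moreover have "norm (fst z *\<^sub>R e) \<le> norm e"
      using mult_right_mono[OF z(1), of "norm e"] by simp
    ultimately show "norm z \<le> 1 + (r + norm e)"
      using z norm_Pair_le[of "fst z" "snd z"] by simp
  qed
  then have int: "integrable (lborel \<Otimes>\<^sub>M lborel) (case_prod ?F)" by (simp add: lborel_prod)
  have "(\<integral>x. (\<integral>s. ?F s x \<partial>lborel) \<partial>lborel) = (\<integral>s. (\<integral>x. ?F s x \<partial>lborel) \<partial>lborel)"
    by (rule lborel_pair.Fubini_integral[OF int])
  also have "\<dots> = (\<integral>s. indicator {-1/2..1/2::real} s * (\<integral>x. f x \<partial>lborel) \<partial>lborel)"
    by (simp add: integral_lborel_translate)
  also have "\<dots> = (\<integral>x. f x \<partial>lborel)" by simp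
  finally show ?thesis .
qed

section \<open>Integration by parts on sublevel sets and the layer cake formula\<close>

context convex_sublevels
begin

lemma window_iff:
  "(t, x) \<in> window e \<longleftrightarrow> chord e t x \<noteq> {} \<and> - 1/2 < exit e t x \<and> exit e t x \<le> 1/2"
  by (auto simp: window_def lines_through_def)

text \<open>The fundamental theorem of calculus on the part of the chord in
  \<open>[-1/2, 1/2]\<close>. Ends of the chord inside the interval give the two window terms; ends
  created by cutting at \<open>1/2\<close> or \<open>-1/2\<close> give the last two terms, which
  cancel after integration over \<open>x\<close>.\<close>

lemma chord_FTC:
  fixes \<psi> \<psi>' :: "'a \<Rightarrow> real"
  assumes e: "norm e = 1"
    and deriv: "\<And>y s. ((\<lambda>s. \<psi> (y + s *\<^sub>R e)) has_real_derivative \<psi>' (y + s *\<^sub>R e)) (at s)"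
    and cont: "continuous_on UNIV \<psi>'"
  shows "(\<integral>s. indicator {-1/2..1/2} s * (indicator {y. T y < ereal t} (x + s *\<^sub>R e) * \<psi>' (x + s *\<^sub>R e)) \<partial>lborel)
    = indicator (window e) (t, x) * \<psi> (exit_pt e t x)
      - indicator (window (- e)) (t, x) * \<psi> (exit_pt (- e) t x)
      + indicator {y. T y < ereal t} (x + (1/2) *\<^sub>R e) * \<psi> (x + (1/2) *\<^sub>R e)
      - indicator {y. T y < ereal t} (x + (-1/2) *\<^sub>R e) * \<psi> (x + (-1/2) *\<^sub>R e)" (is "?L = ?R")
proof -
  let ?U = "{y. T y < ereal t}"
  have U: "x + s *\<^sub>R e \<in> ?U \<longleftrightarrow> s \<in> chord e t x" for s by (simp add: chord_def)
  show ?thesis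
  proof (cases "chord e t x = {}")
    case True
    then have ind: "indicator ?U (x + s *\<^sub>R e) = (0::real)" for s using U[of s] by (auto simp: indicator_def)
    have "(t, x) \<notin> window e" "(t, x) \<notin> window (- e)"
      using True by (auto simp: window_iff chord_uminus_eq_empty)
    then show ?thesis unfolding ind by simp
  next
    case False
    define \<alpha> where "\<alpha> = - exit (- e) t x"
    define \<beta> where "\<beta> = exit e t x"
    have chord: "chord e t x = {\<alpha><..<\<beta>}" using chord_eq[OF e False] by (simp add: \<alpha>_def \<beta>_def)
    then have lt: "\<alpha> < \<beta>" using False by auto
    \<comment> \<open>For \<open>- e\<close> the half-open condition is reflected: it includes
      \<open>-1/2\<close> and excludes \<open>1/2\<close>. Each end of the chord is thus either a
      window term or cut off, also in the boundary cases.\<close>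
    have We: "(t, x) \<in> window e \<longleftrightarrow> - 1/2 < \<beta> \<and> \<beta> \<le> 1/2"
      and Wm: "(t, x) \<in> window (- e) \<longleftrightarrow> - 1/2 \<le> \<alpha> \<and> \<alpha> < 1/2"
      using False by (auto simp: window_iff chord_uminus_eq_empty \<alpha>_def \<beta>_def)
    have pe: "exit_pt e t x = x + \<beta> *\<^sub>R e" "exit_pt (- e) t x = x + \<alpha> *\<^sub>R e"
      by (simp_all add: exit_pt_def \<alpha>_def \<beta>_def)
    define a where "a = max \<alpha> (-1/2)"
    define c where "c = min \<beta> (1/2)"
    have [measurable]: "\<psi>' \<in> borel_measurable borel" by (intro borel_measurable_continuous_onI cont)
    have [measurable]: "?U \<in> sets borel" using open_sublevel by auto
    have "?L = (\<integral>s. indicator {a..c} s * \<psi>' (x + s *\<^sub>R e) \<partial>lborel)"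
    proof (rule integral_cong_AE)
      show "AE s in lborel. indicator {-1/2..1/2} s * (indicator ?U (x + s *\<^sub>R e) * \<psi>' (x + s *\<^sub>R e))
          = indicator {a..c} s * \<psi>' (x + s *\<^sub>R e)"
        using AE_lborel_singleton[of \<alpha>] AE_lborel_singleton[of \<beta>]
      proof eventually_elim
        case (elim s)
        have "s \<in> {-1/2..1/2} \<and> s \<in> chord e t x \<longleftrightarrow> s \<in> {a..c}"
          using elim by (auto simp: a_def c_def chord)
        then have "indicator {-1/2..1/2} s * indicator ?U (x + s *\<^sub>R e) = (indicator {a..c} s :: real)"
          unfolding indicator_def U of_bool_conj[symmetric] by (simp only: if_cong)
        then show ?case by (simp only: mult.assoc[symmetric])
      qed
    qed measurable
    also have "\<dots> = (if a \<le> c then \<psi> (x + c *\<^sub>R e) - \<psi> (x + a *\<^sub>R e) else 0)"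
    proof (cases "a \<le> c")
      case True
      have "(\<integral>s. \<psi>' (x + s *\<^sub>R e) * indicator {a..c} s \<partial>lborel) = \<psi> (x + c *\<^sub>R e) - \<psi> (x + a *\<^sub>R e)"
      proof (rule integral_FTC_Icc_real[OF True])
        show "isCont (\<lambda>s. \<psi>' (x + s *\<^sub>R e)) s" for s
          using continuous_on_compose2[OF cont, of UNIV "\<lambda>s. x + s *\<^sub>R e"]
          by (auto intro: continuous_intros simp: continuous_on_eq_continuous_at)
      qed (rule deriv)
      then show ?thesis using True by (simp add: mult.commute)
    qed auto
    also have "\<dots> = ?R"
    proof -
      have U': "indicator ?U (x + s *\<^sub>R e) = (if \<alpha> < s \<and> s < \<beta> then 1 else 0::real)" for s
        using U[of s] by (auto simp: chord indicator_def)
      have W': "indicator (window e) (t, x) = (if - 1/2 < \<beta> \<and> \<beta> \<le> 1/2 then 1 else 0::real)"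
        "indicator (window (- e)) (t, x) = (if - 1/2 \<le> \<alpha> \<and> \<alpha> < 1/2 then 1 else 0::real)"
        using We Wm by (auto simp: indicator_def)
      have ac: "c = (if \<beta> \<le> 1/2 then \<beta> else 1/2)" "a = (if \<alpha> \<le> -1/2 then -1/2 else \<alpha>)"
        by (auto simp: a_def c_def)
      \<comment> \<open>If the chord starts exactly at \<open>1/2\<close>, the interval from
        \<open>a\<close> to \<open>c\<close> is a single point and both sides are 0; the two forms
        of this point have to be identified.\<close>
      have half: "\<psi> (x + \<alpha> *\<^sub>R e) = \<psi> (x + (1/2) *\<^sub>R e)" if "\<alpha> * 2 = 1"
        using that by (metis nonzero_eq_divide_eq zero_neq_numeral)
      show ?thesis unfolding U' W' pe
        using lt by (cases "\<beta> \<le> 1/2"; cases "-1/2 < \<beta>"; cases "\<alpha> < 1/2"; cases "\<alpha> < -1/2"; cases "\<alpha> = -1/2")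
          (simp_all add: ac half)
    qed
    finally show ?thesis .
  qed
qed

lemma measurable_flux_integrand:
  fixes \<psi> :: "'a \<Rightarrow> real"
  assumes e: "norm e = 1" and [measurable]: "\<psi> \<in> borel_measurable borel"
  shows "(\<lambda>z. indicator (window e) z * \<psi> (exit_pt e (fst z) (snd z))) \<in> borel_measurable borel"
proof -
  note [measurable] = borel_window[OF e] measurable_exit_pt[OF e]
  show ?thesis by measurable
qed

lemma measurable_flux_integrand_section:
  fixes \<psi> :: "'a \<Rightarrow> real"
  assumes e: "norm e = 1" and [measurable]: "\<psi> \<in> borel_measurable borel"
  shows "(\<lambda>x. indicator (window e) (t, x) * \<psi> (exit_pt e t x)) \<in> borel_measurable borel"
proof -
  have "Pair t \<in> borel_measurable borel"
    by (intro borel_measurable_continuous_onI continuous_intros)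
  from measurable_compose[OF this measurable_flux_integrand[OF assms]] show ?thesis by simp
qed

lemma norm_window_le:
  assumes e: "norm e = 1" and "(t, x) \<in> window e" "norm (exit_pt e t x) \<le> r"
  shows "norm x \<le> r + 1"
proof -
  have "norm x \<le> norm (exit_pt e t x) + norm (exit e t x *\<^sub>R e)"
    unfolding exit_pt_def by (metis add_diff_cancel_right' norm_triangle_ineq4)
  moreover have "\<bar>exit e t x\<bar> \<le> 1" using assms(2) by (auto simp: window_iff)
  ultimately show ?thesis using assms by simp
qed

text \<open>Gauss's formula for \<open>{T < t}\<close> in direction \<open>e\<close>, with the
  boundary split according to whether lines leave it along \<open>e\<close> or along
  \<open>- e\<close>. The cutting terms are translates of one integrable function, so their
  integrals cancel.\<close>

lemma integral_sublevel_derivative: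
  fixes \<psi> \<psi>' :: "'a \<Rightarrow> real"
  assumes e: "norm e = 1"
    and deriv: "\<And>y s. ((\<lambda>s. \<psi> (y + s *\<^sub>R e)) has_real_derivative \<psi>' (y + s *\<^sub>R e)) (at s)"
    and cont: "continuous_on UNIV \<psi>" "continuous_on UNIV \<psi>'"
    and bound: "\<And>x. \<bar>\<psi> x\<bar> \<le> C" "\<And>x. \<bar>\<psi>' x\<bar> \<le> C"
    and supp: "\<And>x. \<psi> x \<noteq> 0 \<Longrightarrow> norm x \<le> r" "\<And>x. \<psi>' x \<noteq> 0 \<Longrightarrow> norm x \<le> r"
  shows "(\<integral>x. indicator {y. T y < ereal t} x * \<psi>' x \<partial>lborel)
    = (\<integral>x. indicator (window e) (t, x) * \<psi> (exit_pt e t x) \<partial>lborel)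
      - (\<integral>x. indicator (window (- e)) (t, x) * \<psi> (exit_pt (- e) t x) \<partial>lborel)"
proof -
  let ?U = "{y. T y < ereal t}"
  have [measurable]: "\<psi> \<in> borel_measurable borel" "\<psi>' \<in> borel_measurable borel"
    by (intro borel_measurable_continuous_onI cont)+
  have [measurable]: "?U \<in> sets borel" using open_sublevel by auto
  have e': "norm (- e) = 1" using e by simp
  have C: "0 \<le> C" using bound(1)[of 0] by linarith
  have w: "integrable lborel (\<lambda>x. indicator (window e) (t, x) * \<psi> (exit_pt e t x))" if "norm e = 1" for e
  proof (rule integrable_lborel_bounded_support[of _ C "r + 1"])
    show "(\<lambda>x. indicator (window e) (t, x) * \<psi> (exit_pt e t x)) \<in> borel_measurable borel"
      by (rule measurable_flux_integrand_section[OF that]) measurable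
    show "norm (indicator (window e) (t, x) * \<psi> (exit_pt e t x)) \<le> C" for x
      using bound(1)[of "exit_pt e t x"] C by (auto simp: indicator_def)
    show "norm x \<le> r + 1" if "indicator (window e) (t, x) * \<psi> (exit_pt e t x) \<noteq> 0" for x
      using that supp(1)[of "exit_pt e t x"] by (intro norm_window_le[OF \<open>norm e = 1\<close>]) (auto simp: indicator_def split: if_splits)
  qed
  have g0: "integrable lborel (\<lambda>x. indicator ?U x * \<psi> x)"
    using bound(1) C by (intro integrable_lborel_bounded_support[of _ C r]) (auto simp: indicator_def supp split: if_splits)
  have g: "integrable lborel (\<lambda>x. indicator ?U (x + c) * \<psi> (x + c))" for c
  proof (rule integrable_lborel_bounded_support[of _ C "r + norm c"])
    show "norm x \<le> r + norm c" if "indicator ?U (x + c) * \<psi> (x + c) \<noteq> 0" for x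
    proof -
      have "norm (x + c) \<le> r" using that supp(1)[of "x + c"] by auto
      then show ?thesis using norm_triangle_ineq4[of "x + c" c] by simp
    qed
  qed (use bound(1) C in \<open>auto simp: indicator_def\<close>)
  have tr: "(\<integral>x. indicator ?U (x + c) * \<psi> (x + c) \<partial>lborel) = (\<integral>x. indicator ?U x * \<psi> x \<partial>lborel)" for c
    by (rule integral_lborel_translate[where f="\<lambda>x. indicator ?U x * \<psi> x"]) measurable
  have "(\<integral>x. indicator ?U x * \<psi>' x \<partial>lborel)
      = (\<integral>x. (\<integral>s. indicator {-1/2..1/2} s * (indicator ?U (x + s *\<^sub>R e) * \<psi>' (x + s *\<^sub>R e)) \<partial>lborel) \<partial>lborel)"
    using bound(2) C supp(2)
    by (intro integral_segments[of "\<lambda>x. indicator ?U x * \<psi>' x" C r, symmetric]) (auto simp: indicator_def split: if_splits)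
  also have "\<dots> = (\<integral>x. indicator (window e) (t, x) * \<psi> (exit_pt e t x)
      - indicator (window (- e)) (t, x) * \<psi> (exit_pt (- e) t x)
      + indicator ?U (x + (1/2) *\<^sub>R e) * \<psi> (x + (1/2) *\<^sub>R e)
      - indicator ?U (x + (-1/2) *\<^sub>R e) * \<psi> (x + (-1/2) *\<^sub>R e) \<partial>lborel)"
    by (simp only: chord_FTC[OF e deriv cont(2)])
  also have "\<dots> = (\<integral>x. indicator (window e) (t, x) * \<psi> (exit_pt e t x) \<partial>lborel)
      - (\<integral>x. indicator (window (- e)) (t, x) * \<psi> (exit_pt (- e) t x) \<partial>lborel)"
    using w[OF e] w[OF e'] g[of "(1/2) *\<^sub>R e"] g[of "(-1/2) *\<^sub>R e"]
    by (simp only: Bochner_Integration.integral_add Bochner_Integration.integral_diff tr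
        Bochner_Integration.integrable_add Bochner_Integration.integrable_diff diff_add_cancel add_diff_cancel)
  finally show ?thesis .
qed

lemma integral_flux:
  fixes \<psi> :: "'a \<Rightarrow> real"
  assumes e: "norm e = 1" and [measurable]: "\<psi> \<in> borel_measurable borel"
  shows "(\<integral>x. \<psi> x \<partial>flux e) = (\<integral>z. indicator (window e) z * \<psi> (exit_pt e (fst z) (snd z)) \<partial>lborel)"
proof -
  note [measurable] = borel_window[OF e] measurable_exit_pt[OF e]
  have "density lborel (indicator (window e) :: _ \<Rightarrow> ennreal) = density lborel (\<lambda>z. ennreal (indicator (window e) z))"
    by (intro arg_cong2[where f=density] refl ext) (auto simp: indicator_def)
  then show ?thesis unfolding flux_def by (simp add: integral_distr integral_density)
qed

lemma integral_layer_cake: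
  assumes "T x < ereal c"
  shows "(\<integral>t. indicator {0..c} t * (indicator {y. T y < ereal t} x * k) \<partial>lborel) = (c - real_of_ereal (T x)) * k"
proof -
  obtain \<tau> where \<tau>: "T x = ereal \<tau>" "0 \<le> \<tau>" "\<tau> < c"
    using assms T_nonneg[of x] by (cases "T x") auto
  have "(\<integral>t. indicator {0..c} t * (indicator {y. T y < ereal t} x * k) \<partial>lborel) = (\<integral>t. indicator {\<tau><..c} t * k \<partial>lborel)"
    using \<tau> by (intro Bochner_Integration.integral_cong) (auto simp: indicator_def)
  also have "\<dots> = (c - \<tau>) * k" using \<tau> by simp
  finally show ?thesis using \<tau> by simp
qed

text \<open>On the support, \<open>T\<close> is \<open>c\<close> minus the length of the set of
  levels in \<open>[0, c]\<close> above it. The constant \<open>c\<close> contributes nothing since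
  the integral of \<open>\<psi>'\<close> is zero, and Fubini reduces the rest to Gauss's formula at
  each level.\<close>

lemma integral_T_derivative:
  fixes \<psi> \<psi>' :: "'a \<Rightarrow> real"
  assumes e: "norm e = 1"
    and deriv: "\<And>y s. ((\<lambda>s. \<psi> (y + s *\<^sub>R e)) has_real_derivative \<psi>' (y + s *\<^sub>R e)) (at s)"
    and cont: "continuous_on UNIV \<psi>" "continuous_on UNIV \<psi>'"
    and bound: "\<And>x. \<bar>\<psi> x\<bar> \<le> C" "\<And>x. \<bar>\<psi>' x\<bar> \<le> C"
    and supp: "\<And>x. \<psi> x \<noteq> 0 \<Longrightarrow> norm x \<le> r" "\<And>x. \<psi>' x \<noteq> 0 \<Longrightarrow> norm x \<le> r"
    and supp_T: "\<And>x. \<psi> x \<noteq> 0 \<Longrightarrow> T x < ereal c" "\<And>x. \<psi>' x \<noteq> 0 \<Longrightarrow> T x < ereal c"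
  shows "integrable (flux e) \<psi>"
    and "(\<integral>x. real_of_ereal (T x) * \<psi>' x \<partial>lborel) = - ((\<integral>x. \<psi> x \<partial>flux e) - (\<integral>x. \<psi> x \<partial>flux (- e)))"
proof -
  have [measurable]: "\<psi> \<in> borel_measurable borel" "\<psi>' \<in> borel_measurable borel"
    by (intro borel_measurable_continuous_onI cont)+
  have C: "0 \<le> C" using bound(1)[of 0] by linarith
  have e': "norm (- e) = 1" using e by simp
  define F where "F e z = indicator (window e) z * \<psi> (exit_pt e (fst z) (snd z))" for e and z :: "real \<times> 'a"
  \<comment> \<open>An exit point at level \<open>t\<close> has \<open>T = t\<close>, so the support
    of \<open>\<psi>\<close> bounds the level as well as the base point.\<close>
  have F0: "0 \<le> t \<and> t \<le> c \<and> norm x \<le> r + 1" if e: "norm e = 1" and "F e (t, x) \<noteq> 0" for e t x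
  proof -
    have w: "(t, x) \<in> window e" "\<psi> (exit_pt e t x) \<noteq> 0" using that(2) by (auto simp: F_def indicator_def split: if_splits)
    then have "T (exit_pt e t x) = ereal t" by (intro T_exit_pt[OF e]) (auto simp: window_iff)
    then show ?thesis 
      using supp_T(1)[OF w(2)] T_nonneg[of "exit_pt e t x"] norm_window_le[OF e w(1) supp(1)[OF w(2)]] by auto
  qed
  have Fint: "integrable lborel (F e)" if e: "norm e = 1" for e
  proof (rule integrable_lborel_bounded_support[of _ C "c + (r + 1)"])
    show "F e \<in> borel_measurable borel" unfolding F_def by (rule measurable_flux_integrand[OF e]) measurable
    show "norm (F e z) \<le> C" for z using bound(1) C by (auto simp: F_def indicator_def)
    show "norm z \<le> c + (r + 1)" if "F e z \<noteq> 0" for z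
      using F0[OF e, of "fst z" "snd z"] that norm_Pair_le[of "fst z" "snd z"] by simp
  qed
  then have Fint': "integrable (lborel \<Otimes>\<^sub>M lborel) (F e)" if "norm e = 1" for e
    using that by (simp add: lborel_prod)
  show "integrable (flux e) \<psi>"
  proof -
    note [measurable] = borel_window[OF e] measurable_exit_pt[OF e]
    have "density lborel (indicator (window e) :: _ \<Rightarrow> ennreal) = density lborel (\<lambda>z. ennreal (indicator (window e) z))"
      by (intro arg_cong2[where f=density] refl ext) (auto simp: indicator_def)
    then show ?thesis unfolding flux_def using Fint[OF e]
      by (simp add: integrable_distr_eq integrable_density F_def[abs_def])
  qed
  let ?I = "\<lambda>t. \<integral>x. indicator {y. T y < ereal t} x * \<psi>' x \<partial>lborel"
  have I: "?I t = (\<integral>x. F e (t, x) \<partial>lborel) - (\<integral>x. F (- e) (t, x) \<partial>lborel)" for t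
    unfolding F_def using integral_sublevel_derivative[OF e deriv cont bound supp] by simp
  have F_out: "F e (t, x) = 0" if "norm e = 1" "t \<notin> {0..c}" for e t x
    using F0[OF that(1), of t x] that(2) by auto
  \<comment> \<open>The support of \<open>\<psi>\<close> lies strictly inside
    \<open>{T < c}\<close>, so the boundary terms vanish at level \<open>c\<close>; there Gauss's
    formula says that \<open>\<psi>'\<close> has integral zero.\<close>
  have F_c: "F e (c, x) = 0" if "norm e = 1" for e x
  proof (rule ccontr)
    assume "F e (c, x) \<noteq> 0"
    then have w: "(c, x) \<in> window e" "\<psi> (exit_pt e c x) \<noteq> 0" by (auto simp: F_def indicator_def split: if_splits)
    then have "T (exit_pt e c x) = ereal c" by (intro T_exit_pt[OF that]) (auto simp: window_iff)
    then show False using supp_T(1)[OF w(2)] by simp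
  qed
  have "(\<integral>x. \<psi>' x \<partial>lborel) = ?I c"
    using supp_T(2) by (intro Bochner_Integration.integral_cong) (auto simp: indicator_def)
  also have "\<dots> = 0" unfolding I by (simp add: F_c e e')
  finally have zero: "(\<integral>x. \<psi>' x \<partial>lborel) = 0" .
  let ?G = "\<lambda>t x. indicator {0..c} t * (indicator {y. T y < ereal t} x * \<psi>' x)"
  have "open {z::real \<times> 'a. T (snd z) < ereal (fst z)}" by (intro open_Collect_less continuous_intros)
  then have [measurable]: "{z::real \<times> 'a. T (snd z) < ereal (fst z)} \<in> sets (borel \<Otimes>\<^sub>M borel)"
    unfolding borel_prod by (rule borel_open)
  have "case_prod ?G = (\<lambda>z. indicator {0..c} (fst z) * (indicator {z. T (snd z) < ereal (fst z)} z * \<psi>' (snd z)))"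
    by (auto simp: indicator_def)
  also have "\<dots> \<in> borel_measurable (borel \<Otimes>\<^sub>M borel)" by measurable
  finally have Gm: "case_prod ?G \<in> borel_measurable borel" by (simp add: borel_prod)
  have "integrable lborel (case_prod ?G)"
  proof (rule integrable_lborel_bounded_support[OF Gm, of C "c + r"])
    show "norm (case_prod ?G z) \<le> C" for z using bound(2) C by (auto simp: indicator_def split_beta)
    show "norm z \<le> c + r" if "case_prod ?G z \<noteq> 0" for z
      using that supp(2)[of "snd z"] norm_Pair_le[of "fst z" "snd z"]
      by (auto simp: indicator_def split_beta split: if_splits)
  qed
  then have Gint: "integrable (lborel \<Otimes>\<^sub>M lborel) (case_prod ?G)" by (simp add: lborel_prod)
  have "real_of_ereal (T x) * \<psi>' x = c * \<psi>' x - (\<integral>t. ?G t x \<partial>lborel)" for x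
    using integral_layer_cake[of x c "\<psi>' x"] supp_T(2)[of x] by (cases "\<psi>' x = 0") (auto simp: algebra_simps)
  then have "(\<integral>x. real_of_ereal (T x) * \<psi>' x \<partial>lborel) = (\<integral>x. c * \<psi>' x - (\<integral>t. ?G t x \<partial>lborel) \<partial>lborel)" by simp
  also have "\<dots> = (\<integral>x. c * \<psi>' x \<partial>lborel) - (\<integral>x. (\<integral>t. ?G t x \<partial>lborel) \<partial>lborel)"
  proof (rule Bochner_Integration.integral_diff)
    show "integrable lborel (\<lambda>x. c * \<psi>' x)"
      using bound(2) supp(2) by (intro integrable_mult_right integrable_lborel_bounded_support[of _ C r]) auto
    show "integrable lborel (\<lambda>x. \<integral>t. ?G t x \<partial>lborel)" by (rule lborel_pair.integrable_snd[OF Gint])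
  qed
  also have "\<dots> = - (\<integral>x. (\<integral>t. ?G t x \<partial>lborel) \<partial>lborel)" using zero by simp
  also have "(\<integral>x. (\<integral>t. ?G t x \<partial>lborel) \<partial>lborel) = (\<integral>t. (\<integral>x. ?G t x \<partial>lborel) \<partial>lborel)"
    by (rule lborel_pair.Fubini_integral[OF Gint])
  also have "\<dots> = (\<integral>t. (\<integral>x. F e (t, x) \<partial>lborel) - (\<integral>x. F (- e) (t, x) \<partial>lborel) \<partial>lborel)"
  proof (rule Bochner_Integration.integral_cong[OF refl])
    fix t
    show "(\<integral>x. ?G t x \<partial>lborel) = (\<integral>x. F e (t, x) \<partial>lborel) - (\<integral>x. F (- e) (t, x) \<partial>lborel)"
      using I[of t] F_out[OF e, of t] F_out[OF e', of t] by (cases "t \<in> {0..c}") auto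
  qed
  also have "\<dots> = (\<integral>t. (\<integral>x. F e (t, x) \<partial>lborel) \<partial>lborel) - (\<integral>t. (\<integral>x. F (- e) (t, x) \<partial>lborel) \<partial>lborel)"
    by (intro Bochner_Integration.integral_diff lborel_pair.integrable_fst' Fint' e e')
  also have "\<dots> = integral\<^sup>L lborel (F e) - integral\<^sup>L lborel (F (- e))"
    using lborel_pair.integral_fst'[OF Fint'[OF e]] lborel_pair.integral_fst'[OF Fint'[OF e']] by (simp add: lborel_prod)
  also have "\<dots> = (\<integral>x. \<psi> x \<partial>flux e) - (\<integral>x. \<psi> x \<partial>flux (- e))"
    using e e' by (simp add: integral_flux F_def[abs_def])
  finally show "(\<integral>x. real_of_ereal (T x) * \<psi>' x \<partial>lborel) = - ((\<integral>x. \<psi> x \<partial>flux e) - (\<integral>x. \<psi> x \<partial>flux (- e)))" .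
qed

end

section \<open>Compactly supported fields, and local finiteness of the flux\<close>

lemma C1c_field_derivative_off_support:
  assumes "C1c_field \<Omega> \<phi> D" "x \<notin> closure {x. \<phi> x \<noteq> 0}"
  shows "D x = 0"
proof -
  have "(\<phi> has_derivative blinfun_apply (D x)) (at x)" using assms by (auto simp: C1c_field_def)
  moreover have "(\<phi> has_derivative (\<lambda>_. 0)) (at x)"
  proof (rule has_derivative_transform_within_open[of "\<lambda>_. 0" _ _ UNIV])
    show "open (- closure {x. \<phi> x \<noteq> 0})" by auto
    show "x \<in> - closure {x. \<phi> x \<noteq> 0}" using assms by auto
    fix y assume "y \<in> - closure {x. \<phi> x \<noteq> 0}"
    then show "0 = \<phi> y" using closure_subset[of "{x. \<phi> x \<noteq> 0}"] by auto
  qed auto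
  ultimately have "blinfun_apply (D x) = (\<lambda>_. 0)" by (rule has_derivative_unique)
  then show ?thesis by (intro blinfun_eqI) simp
qed

lemma continuous_compact_support_bounded:
  fixes f :: "'a::metric_space \<Rightarrow> real"
  assumes "continuous_on UNIV f" "compact S" "\<And>x. x \<notin> S \<Longrightarrow> f x = 0"
  shows "\<exists>C. \<forall>x. \<bar>f x\<bar> \<le> C"
proof -
  have "bounded (f ` S)"
    using assms by (intro compact_imp_bounded compact_continuous_image) (auto intro: continuous_on_subset)
  then obtain C where "\<And>x. x \<in> S \<Longrightarrow> \<bar>f x\<bar> \<le> C" by (auto simp: bounded_iff)
  then have "\<bar>f x\<bar> \<le> max C 0" for x
    using assms(3)[of x] by (cases "x \<in> S") (auto simp: le_max_iff_disj)
  then show ?thesis by blast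
qed

context convex_sublevels
begin

lemma compact_subset_sublevel:
  assumes "compact K" "K \<subseteq> {x. T x < \<infinity>}"
  obtains c where "K \<subseteq> {x. T x < ereal c}"
proof (cases "K = {}")
  case False
  then obtain x where x: "x \<in> K" "\<And>y. y \<in> K \<Longrightarrow> T y \<le> T x"
    using continuous_attains_sup[OF assms(1) False, of T] continuous_on_subset[OF continuous_T] by auto
  then obtain c where "T x < ereal c" using assms(2) less_PInf_Ex_of_nat by fastforce
  then show ?thesis using x(2) by (intro that[of c]) (auto intro: le_less_trans)
qed auto

text \<open>The parameter set is bounded: the level lies in \<open>[0, c]\<close>, and the window
  keeps the base point within distance 1 of its exit point.\<close>

lemma emeasure_flux_sublevel_finite:
  assumes e: "norm e = 1" and E: "E \<in> sets borel" "E \<subseteq> {x. T x < ereal c}"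
  shows "emeasure (flux e) E < \<infinity>"
proof -
  obtain r where r: "\<And>y. T y < ereal c \<Longrightarrow> norm y \<le> r"
    using bounded_sublevel[of c] unfolding bounded_iff by auto
  have "{z \<in> window e. exit_pt e (fst z) (snd z) \<in> E} \<subseteq> cball 0 (c + (r + 1))"
  proof
    fix z assume "z \<in> {z \<in> window e. exit_pt e (fst z) (snd z) \<in> E}"
    then have w: "(fst z, snd z) \<in> window e" and lt: "T (exit_pt e (fst z) (snd z)) < ereal c" using E by auto
    then have "T (exit_pt e (fst z) (snd z)) = ereal (fst z)" unfolding window_iff by (intro T_exit_pt[OF e]) auto
    then have "0 \<le> fst z" "fst z \<le> c" using lt T_nonneg[of "exit_pt e (fst z) (snd z)"] by auto
    then show "z \<in> cball 0 (c + (r + 1))"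
      using norm_window_le[OF e w r[OF lt]] norm_Pair_le[of "fst z" "snd z"] by simp
  qed
  then have "emeasure lborel {z \<in> window e. exit_pt e (fst z) (snd z) \<in> E} < \<infinity>"
    by (intro emeasure_bounded_finite) (rule bounded_subset[OF bounded_cball])
  then show ?thesis by (simp add: emeasure_flux[OF e E(1)])
qed

lemma emeasure_flux_infinite_level:
  assumes "norm e = 1"
  shows "emeasure (flux e) {x. T x = \<infinity>} = 0"
proof -
  have "{x. T x = \<infinity>} \<in> sets borel" by measurable
  moreover have "{z \<in> window e. exit_pt e (fst z) (snd z) \<in> {x. T x = \<infinity>}} = {}"
    using T_exit_pt[OF assms] by (auto simp: window_def lines_through_def)
  ultimately show ?thesis using emeasure_flux[OF assms] by (metis emeasure_empty)
qed

text \<open>Needed for the Radon-Nikodym theorem. Sublevels at natural numbers cover the domain, and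
  its complement has no flux because exit points have finite level.\<close>

lemma sigma_finite_flux:
  assumes e: "norm e = 1"
  shows "sigma_finite_measure (flux e)"
proof
  let ?A = "insert {x. T x = \<infinity>} (range (\<lambda>n::nat. {x. T x < ereal (real n)}))"
  have "\<Union>?A = UNIV"
  proof (intro set_eqI iffI UNIV_I)
    fix x
    show "x \<in> \<Union>?A"
    proof (cases "T x = \<infinity>")
      case False
      then obtain n where "T x < ereal (real n)" using less_PInf_Ex_of_nat[of "T x"] by auto
      then show ?thesis by auto
    qed auto
  qed
  moreover have "emeasure (flux e) a \<noteq> \<infinity>" if "a \<in> ?A" for a
    using that emeasure_flux_infinite_level[OF e]
      emeasure_flux_sublevel_finite[OF e borel_open[OF open_sublevel] subset_refl]
    by (auto simp: less_top)
  moreover have "?A \<subseteq> sets (flux e)" using open_sublevel by auto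
  ultimately show "\<exists>A. countable A \<and> A \<subseteq> sets (flux e) \<and> \<Union> A = space (flux e) \<and> (\<forall>a\<in>A. emeasure (flux e) a \<noteq> \<infinity>)"
    by (intro exI[of _ ?A]) auto
qed

lemma borel_domain: "{x. T x < \<infinity>} \<in> sets borel"
  by (intro borel_open open_Collect_less continuous_intros)

lemma measurable_real_T [measurable]: "(\<lambda>x. real_of_ereal (T x)) \<in> borel_measurable borel"
  by measurable

lemma absolutely_integrable_T:
  assumes "compact K" "K \<subseteq> {x. T x < \<infinity>}"
  shows "(\<lambda>x. real_of_ereal (T x)) absolutely_integrable_on K"
proof -
  have "\<bar>T x\<bar> \<noteq> \<infinity>" if "x \<in> K" for x using that assms(2) T_nonneg[of x] by (cases "T x") auto
  then have "continuous_on K (real_of_ereal \<circ> T)"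
    using continuous_on_iff_real[of K T] continuous_on_subset[OF continuous_T] by auto
  then have "integrable lborel (\<lambda>x. indicator K x *\<^sub>R real_of_ereal (T x))"
    using borel_integrable_compact[OF assms(1), of "\<lambda>x. real_of_ereal (T x)"] by (simp add: o_def)
  moreover have [measurable]: "K \<in> sets borel" using assms by (simp add: compact_imp_closed)
  ultimately show ?thesis unfolding set_integrable_def by (intro integrable_completion[THEN iffD2]) auto
qed

end

section \<open>The weak gradient and the polar decomposition of the derivative\<close>

context expanding_sublevels
begin

definition flux_density :: "'a \<Rightarrow> 'a \<Rightarrow> real" where
  "flux_density e x = enn2real (RN_deriv lborel (flux e) x)"

text \<open>\<open>T\<close> increases where lines in direction \<open>i\<close> leave the sublevel
  sets, hence the sign. The indicator fixes a representative that vanishes everywhere outside the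
  domain, as the representing measure must.\<close>

definition gradient :: "'a \<Rightarrow> 'a" where
  "gradient x = indicator {x. T x < \<infinity>} x *\<^sub>R (\<Sum>i\<in>Basis. (flux_density i x - flux_density (- i) x) *\<^sub>R i)"

lemma measurable_flux_density [measurable]: "flux_density e \<in> borel_measurable borel"
proof -
  have [measurable]: "RN_deriv lborel (flux e) \<in> borel_measurable borel"
    using borel_measurable_RN_deriv[of lborel "flux e"] by simp
  show ?thesis unfolding flux_density_def by measurable
qed

lemma measurable_gradient [measurable]: "gradient \<in> borel_measurable borel"
proof -
  note [measurable] = borel_domain
  show ?thesis unfolding gradient_def by measurable
qed

lemma
  fixes \<psi> :: "'a \<Rightarrow> real"
  assumes e: "norm e = 1" and "\<psi> \<in> borel_measurable borel"
  shows integrable_flux_iff: "integrable (flux e) \<psi> \<longleftrightarrow> integrable lborel (\<lambda>x. flux_density e x * \<psi> x)"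
    and integral_flux_density: "(\<integral>x. \<psi> x \<partial>flux e) = (\<integral>x. flux_density e x * \<psi> x \<partial>lborel)"
  unfolding flux_density_def
  using sigma_finite_measure.RN_deriv_integrable[OF sigma_finite_lborel sigma_finite_flux[OF e] absolutely_continuous_flux[OF e], of \<psi>]
    sigma_finite_measure.RN_deriv_integral[OF sigma_finite_lborel sigma_finite_flux[OF e] absolutely_continuous_flux[OF e], of \<psi>] assms
  by auto

text \<open>Stated as an inequality because \<open>enn2real\<close> sends an infinite derivative to
  0; an upper bound is what local finiteness of the derivative requires.\<close>

lemma nn_integral_flux_density_le:
  assumes e: "norm e = 1" and E: "E \<in> sets borel"
  shows "(\<integral>\<^sup>+x. ennreal (flux_density e x) * indicator E x \<partial>lborel) \<le> emeasure (flux e) E"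
proof -
  have [measurable]: "RN_deriv lborel (flux e) \<in> borel_measurable borel"
    using borel_measurable_RN_deriv[of lborel "flux e"] by simp
  have "emeasure (flux e) E = emeasure (density lborel (RN_deriv lborel (flux e))) E"
    by (subst sigma_finite_measure.density_RN_deriv[OF sigma_finite_lborel]) (auto intro: absolutely_continuous_flux[OF e])
  also have "\<dots> = (\<integral>\<^sup>+x. RN_deriv lborel (flux e) x * indicator E x \<partial>lborel)"
    using E by (simp add: emeasure_density)
  also have "\<dots> \<ge> (\<integral>\<^sup>+x. ennreal (flux_density e x) * indicator E x \<partial>lborel)"
    unfolding flux_density_def
    by (intro nn_integral_mono mult_right_mono) (auto simp: ennreal_enn2real_if)
  finally show ?thesis .
qed

lemma emeasure_gradient_finite:
  assumes "compact K" "K \<subseteq> {x. T x < \<infinity>}"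
  shows "emeasure (density lborel (\<lambda>x. ennreal (norm (gradient x)))) K < \<infinity>"
proof -
  obtain c where c: "K \<subseteq> {x. T x < ereal c}" using compact_subset_sublevel[OF assms] .
  have K[measurable]: "K \<in> sets borel" using assms by (simp add: compact_imp_closed)
  have le: "norm (gradient x) \<le> (\<Sum>i\<in>Basis. flux_density i x + flux_density (- i) x)" for x
  proof -
    have nn: "0 \<le> flux_density e x" for e by (simp add: flux_density_def)
    have "norm (gradient x) \<le> norm (\<Sum>i\<in>Basis. (flux_density i x - flux_density (- i) x) *\<^sub>R i)"
      unfolding gradient_def by (auto simp: indicator_def)
    also have "\<dots> \<le> (\<Sum>i\<in>Basis. norm ((flux_density i x - flux_density (- i) x) *\<^sub>R i))" by (rule norm_sum)
    also have "\<dots> \<le> (\<Sum>i\<in>Basis. flux_density i x + flux_density (- i) x)"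
    proof (rule sum_mono)
      fix i :: 'a assume "i \<in> Basis"
      then have "norm ((flux_density i x - flux_density (- i) x) *\<^sub>R i) = \<bar>flux_density i x - flux_density (- i) x\<bar>" by simp
      then show "norm ((flux_density i x - flux_density (- i) x) *\<^sub>R i) \<le> flux_density i x + flux_density (- i) x"
        using nn[of i] nn[of "- i"] by linarith
    qed
    finally show ?thesis .
  qed
  have "emeasure (density lborel (\<lambda>x. ennreal (norm (gradient x)))) K
      = (\<integral>\<^sup>+x. ennreal (norm (gradient x)) * indicator K x \<partial>lborel)" by (simp add: emeasure_density)
  also have "\<dots> \<le> (\<integral>\<^sup>+x. (\<Sum>i\<in>Basis. ennreal (flux_density i x) * indicator K x + ennreal (flux_density (- i) x) * indicator K x) \<partial>lborel)"
  proof (intro nn_integral_mono)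
    fix x
    have "ennreal (norm (gradient x)) \<le> ennreal (\<Sum>i\<in>Basis. flux_density i x + flux_density (- i) x)"
      using le by (rule ennreal_leI)
    also have "\<dots> = (\<Sum>i\<in>Basis. ennreal (flux_density i x) + ennreal (flux_density (- i) x))"
      by (subst sum_ennreal[symmetric]) (auto simp: flux_density_def ennreal_plus intro!: sum.cong)
    finally show "ennreal (norm (gradient x)) * indicator K x
      \<le> (\<Sum>i\<in>Basis. ennreal (flux_density i x) * indicator K x + ennreal (flux_density (- i) x) * indicator K x)"
      by (auto simp: indicator_def)
  qed
  also have "\<dots> = (\<Sum>i\<in>Basis. (\<integral>\<^sup>+x. ennreal (flux_density i x) * indicator K x \<partial>lborel)
      + (\<integral>\<^sup>+x. ennreal (flux_density (- i) x) * indicator K x \<partial>lborel))"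
    by (simp add: nn_integral_sum nn_integral_add)
  also have "\<dots> < \<infinity>"
  proof -
    have "(\<integral>\<^sup>+x. ennreal (flux_density e x) * indicator K x \<partial>lborel) < top" if "norm e = 1" for e
      using nn_integral_flux_density_le[OF that K] emeasure_flux_sublevel_finite[OF that K c]
      by (auto intro: le_less_trans)
    then show ?thesis by (simp add: less_top[symmetric])
  qed
  finally show ?thesis .
qed

lemma integral_T_divergence:
  assumes \<phi>: "C1c_field {x. T x < \<infinity>} \<phi> D"
  shows "(\<integral>x. real_of_ereal (T x) * divergence D x \<partial>lborel) = - (\<integral>x. \<phi> x \<bullet> gradient x \<partial>lborel)"
proof -
  define S where "S = closure {x. \<phi> x \<noteq> 0}"
  have S: "compact S" "S \<subseteq> {x. T x < \<infinity>}" and D: "\<And>x. (\<phi> has_derivative blinfun_apply (D x)) (at x)"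
    and Dc: "continuous_on UNIV D"
    using \<phi> by (auto simp: C1c_field_def S_def)
  have \<phi>0: "\<phi> x = 0" if "x \<notin> S" for x using that closure_subset[of "{x. \<phi> x \<noteq> 0}"] by (auto simp: S_def)
  have D0: "D x = 0" if "x \<notin> S" for x using C1c_field_derivative_off_support[OF \<phi>] that by (simp add: S_def)
  obtain c where c: "S \<subseteq> {x. T x < ereal c}" using compact_subset_sublevel[OF S] .
  obtain r where r: "\<And>x. x \<in> S \<Longrightarrow> norm x \<le> r" using compact_imp_bounded[OF S(1)] by (auto simp: bounded_iff)
  have \<phi>c: "continuous_on UNIV \<phi>" using D has_derivative_continuous by (metis continuous_at_imp_continuous_on)
  note [continuous_intros] = continuous_on_compose2[OF \<phi>c] continuous_on_compose2[OF Dc]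
  have [measurable]: "\<phi> \<in> borel_measurable borel" by (intro borel_measurable_continuous_onI \<phi>c)
  have comp: "integrable lborel (\<lambda>x. real_of_ereal (T x) * (blinfun_apply (D x) i \<bullet> i)) \<and>
      integrable lborel (\<lambda>x. flux_density i x * (\<phi> x \<bullet> i)) \<and> integrable lborel (\<lambda>x. flux_density (- i) x * (\<phi> x \<bullet> i)) \<and>
      (\<integral>x. real_of_ereal (T x) * (blinfun_apply (D x) i \<bullet> i) \<partial>lborel)
       = - ((\<integral>x. flux_density i x * (\<phi> x \<bullet> i) \<partial>lborel) - (\<integral>x. flux_density (- i) x * (\<phi> x \<bullet> i) \<partial>lborel))"
    if i: "i \<in> Basis" for i
  proof -
    let ?p = "\<lambda>x. \<phi> x \<bullet> i" and ?d = "\<lambda>x. blinfun_apply (D x) i \<bullet> i"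
    have n: "norm i = 1" "norm (- i) = 1" using i by auto
    have pc: "continuous_on UNIV ?p" by (intro continuous_intros \<phi>c)
    have dc: "continuous_on UNIV ?d" by (intro continuous_intros Dc)
    have [measurable]: "?d \<in> borel_measurable borel" by (intro borel_measurable_continuous_onI dc)
    obtain C1 where C1: "\<And>x. \<bar>?p x\<bar> \<le> C1"
      using continuous_compact_support_bounded[OF pc S(1)] \<phi>0 by auto
    obtain C2 where C2: "\<And>x. \<bar>?d x\<bar> \<le> C2"
      using continuous_compact_support_bounded[OF dc S(1)] D0 by auto
    define C where "C = max C1 C2"
    have C: "\<bar>?p x\<bar> \<le> C" "\<bar>?d x\<bar> \<le> C" for x using C1[of x] C2[of x] by (auto simp: C_def)
    have pS: "x \<in> S" if "?p x \<noteq> 0" for x using \<phi>0[of x] that by (cases "x \<in> S") auto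
    have dS: "x \<in> S" if "?d x \<noteq> 0" for x using D0[of x] that by (cases "x \<in> S") auto
    have der: "((\<lambda>s. ?p (y + s *\<^sub>R i)) has_real_derivative ?d (y + s *\<^sub>R i)) (at s)" for y s
    proof -
      have "((\<lambda>s. \<phi> (y + s *\<^sub>R i)) has_derivative (\<lambda>h. blinfun_apply (D (y + s *\<^sub>R i)) (h *\<^sub>R i))) (at s)"
        by (rule has_derivative_compose[of "\<lambda>s. y + s *\<^sub>R i" "\<lambda>h. h *\<^sub>R i", OF _ D]) (auto intro!: derivative_eq_intros)
      from has_derivative_inner_left[OF this, of i] show ?thesis
        unfolding has_field_derivative_def
        by (rule has_derivative_eq_rhs) (auto simp: blinfun.scaleR_right mult.commute)
    qed
    have der': "((\<lambda>s. ?p (y + s *\<^sub>R (- i))) has_real_derivative - ?d (y + s *\<^sub>R (- i))) (at s)" for y s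
    proof -
      have "((\<lambda>s. \<phi> (y + s *\<^sub>R (- i))) has_derivative (\<lambda>h. blinfun_apply (D (y + s *\<^sub>R (- i))) (h *\<^sub>R (- i)))) (at s)"
        by (rule has_derivative_compose[of "\<lambda>s. y + s *\<^sub>R (- i)" "\<lambda>h. h *\<^sub>R (- i)", OF _ D]) (auto intro!: derivative_eq_intros)
      from has_derivative_inner_left[OF this, of i] show ?thesis
        unfolding has_field_derivative_def
        by (rule has_derivative_eq_rhs) (auto simp: blinfun.scaleR_right blinfun.minus_right mult.commute)
    qed
    have pm: "?p \<in> borel_measurable borel" by measurable
    have dc': "continuous_on UNIV (\<lambda>x. - ?d x)" using dc by (rule continuous_on_minus)
    have supp: "\<phi> x \<bullet> i \<noteq> 0 \<Longrightarrow> norm x \<le> r" "?d x \<noteq> 0 \<Longrightarrow> norm x \<le> r"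
      "\<phi> x \<bullet> i \<noteq> 0 \<Longrightarrow> T x < ereal c" "?d x \<noteq> 0 \<Longrightarrow> T x < ereal c" for x
      using r[OF pS] r[OF dS] pS dS c by blast+
    note 1 = integral_T_derivative[OF n(1) der pc dc C supp]
    \<comment> \<open>The identity in direction \<open>i\<close> already involves both fluxes; the
      application to \<open>- i\<close> supplies integrability for the second one.\<close>
    have 2: "integrable (flux (- i)) ?p"
      by (rule integral_T_derivative(1)[OF n(2) der' pc dc' C(1), where r=r and c=c]; use C supp in auto)
    have "integrable lborel (\<lambda>x. real_of_ereal (T x) * ?d x)"
    proof (rule integrable_lborel_bounded_support[of _ "\<bar>c\<bar> * C" r])
      show "norm (real_of_ereal (T x) * ?d x) \<le> \<bar>c\<bar> * C" for x
      proof (cases "x \<in> S")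
        case True
        then have "T x < ereal c" using c by auto
        then have "0 \<le> real_of_ereal (T x)" "real_of_ereal (T x) \<le> c" using T_nonneg[of x] by (cases "T x"; auto)+
        then show ?thesis using C[of x] unfolding real_norm_def abs_mult by (intro mult_mono) linarith+
      next
        case False
        then have "?d x = 0" using D0 by simp
        then show ?thesis using C(2)[of x] by simp
      qed
    qed (use r[OF dS] in auto)
    then show ?thesis using 1 2 integrable_flux_iff[OF n(1) pm] integrable_flux_iff[OF n(2) pm]
      integral_flux_density[OF n(1) pm] integral_flux_density[OF n(2) pm] by simp
  qed
  have "(\<integral>x. real_of_ereal (T x) * divergence D x \<partial>lborel)
      = (\<integral>x. (\<Sum>i\<in>Basis. real_of_ereal (T x) * (blinfun_apply (D x) i \<bullet> i)) \<partial>lborel)"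
    by (simp add: divergence_def sum_distrib_left)
  also have "\<dots> = (\<Sum>i\<in>Basis. (\<integral>x. real_of_ereal (T x) * (blinfun_apply (D x) i \<bullet> i) \<partial>lborel))"
    using comp by (intro Bochner_Integration.integral_sum) auto
  also have "\<dots> = (\<Sum>i\<in>Basis. - (\<integral>x. flux_density i x * (\<phi> x \<bullet> i) - flux_density (- i) x * (\<phi> x \<bullet> i) \<partial>lborel))"
    using comp by (intro sum.cong) auto
  also have "\<dots> = - (\<integral>x. (\<Sum>i\<in>Basis. flux_density i x * (\<phi> x \<bullet> i) - flux_density (- i) x * (\<phi> x \<bullet> i)) \<partial>lborel)"
    unfolding sum_negf using comp by (subst Bochner_Integration.integral_sum) auto
  also have "(\<lambda>x. \<Sum>i\<in>Basis. flux_density i x * (\<phi> x \<bullet> i) - flux_density (- i) x * (\<phi> x \<bullet> i)) = (\<lambda>x. \<phi> x \<bullet> gradient x)"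
  proof
    fix x
    show "(\<Sum>i\<in>Basis. flux_density i x * (\<phi> x \<bullet> i) - flux_density (- i) x * (\<phi> x \<bullet> i)) = \<phi> x \<bullet> gradient x"
    proof (cases "x \<in> S")
      case True
      then have "x \<in> {x. T x < \<infinity>}" using S by blast
      then show ?thesis by (simp add: gradient_def inner_sum_right algebra_simps)
    qed (simp add: \<phi>0)
  qed
  finally show ?thesis .
qed

theorem SBV_loc_T: "SBV_loc {x. T x < \<infinity>} (\<lambda>x. real_of_ereal (T x))"
proof -
  define \<mu> where "\<mu> = density lborel (\<lambda>x. ennreal (norm (gradient x)))"
  define \<nu> where "\<nu> = (\<lambda>x. sgn (gradient x))"
  have [measurable]: "\<nu> \<in> borel_measurable borel" unfolding \<nu>_def sgn_div_norm by measurable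
  have sets: "sets \<mu> = sets borel" by (simp add: \<mu>_def)
  have "emeasure \<mu> (UNIV - {x. T x < \<infinity>}) = 0"
  proof -
    have "UNIV - {x. T x < \<infinity>} \<in> sets borel" using borel_domain by auto
    then have "emeasure \<mu> (UNIV - {x. T x < \<infinity>}) 
        = (\<integral>\<^sup>+x. ennreal (norm (gradient x)) * indicator (UNIV - {x. T x < \<infinity>}) x \<partial>lborel)"
      unfolding \<mu>_def by (subst emeasure_density) auto
    also have "\<dots> = (\<integral>\<^sup>+x. 0 \<partial>(lborel :: 'a measure))"
      by (rule nn_integral_cong) (auto simp: gradient_def indicator_def)
    finally show ?thesis by simp
  qed
  moreover have "AE x in \<mu>. norm (\<nu> x) = 1"
    \<comment> \<open>Where the gradient vanishes, \<open>sgn\<close> is 0 instead of a unit vector,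
      but the density makes that set null.\<close>
    unfolding \<mu>_def by (subst AE_density) (auto simp: \<nu>_def norm_sgn)
  moreover have "(LINT x|lebesgue. real_of_ereal (T x) * divergence D x) = - (LINT x|\<mu>. \<phi> x \<bullet> \<nu> x)"
    if \<phi>: "C1c_field {x. T x < \<infinity>} \<phi> D" for \<phi> D
  proof -
    have Dc: "continuous_on UNIV D" and \<phi>c: "continuous_on UNIV \<phi>"
      using \<phi> by (auto simp: C1c_field_def intro!: continuous_at_imp_continuous_on has_derivative_continuous)
    have [measurable]: "divergence D \<in> borel_measurable borel"
      unfolding divergence_def by (intro borel_measurable_continuous_onI continuous_intros Dc)
    have [measurable]: "\<phi> \<in> borel_measurable borel" by (intro borel_measurable_continuous_onI \<phi>c)
    have "(LINT x|lebesgue. real_of_ereal (T x) * divergence D x) = (\<integral>x. real_of_ereal (T x) * divergence D x \<partial>lborel)"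
      by (rule integral_completion) measurable
    also have "\<dots> = - (\<integral>x. \<phi> x \<bullet> gradient x \<partial>lborel)" by (rule integral_T_divergence[OF \<phi>])
    also have "(\<integral>x. \<phi> x \<bullet> gradient x \<partial>lborel) = (\<integral>x. norm (gradient x) *\<^sub>R (\<phi> x \<bullet> \<nu> x) \<partial>lborel)"
    proof (intro Bochner_Integration.integral_cong refl)
      fix x
      have "gradient x = norm (gradient x) *\<^sub>R \<nu> x" by (cases "gradient x = 0") (simp_all add: \<nu>_def sgn_div_norm)
      then show "\<phi> x \<bullet> gradient x = norm (gradient x) *\<^sub>R (\<phi> x \<bullet> \<nu> x)" by (metis inner_scaleR_right real_scaleR_def)
    qed
    also have "\<dots> = (LINT x|\<mu>. \<phi> x \<bullet> \<nu> x)"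
      unfolding \<mu>_def by (rule integral_density[symmetric]) auto
    finally show ?thesis .
  qed
  \<comment> \<open>Absolute continuity gives the Cantor clause for all Lebesgue-null Borel sets at
    once.\<close>
  moreover have "emeasure \<mu> E = 0" if "E \<in> sets borel" "emeasure lebesgue E = 0" for E
  proof -
    have "E \<in> null_sets lborel" using that by auto
    moreover have "absolutely_continuous lborel \<mu>" unfolding \<mu>_def by (rule absolutely_continuousI_density) measurable
    ultimately show ?thesis by (auto simp: absolutely_continuous_def)
  qed
  ultimately show ?thesis
    unfolding SBV_loc_def using sets absolutely_integrable_T emeasure_gradient_finite \<mu>_def
    by (intro conjI exI[of _ \<mu>] exI[of _ \<nu>]) auto
qed

end

section \<open>Exponentials of operators\<close>

text \<open>A copy of the endomorphisms with composition as multiplication, making them a unital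
  Banach algebra in which \<open>exp\<close> is defined.\<close>

typedef (overloaded) ('a::euclidean_space) endo = "UNIV :: ('a \<Rightarrow>\<^sub>L 'a) set" ..

setup_lifting type_definition_endo

instantiation endo :: (euclidean_space) real_normed_algebra_1
begin

lift_definition zero_endo :: "'a endo" is 0 .
lift_definition one_endo :: "'a endo" is id_blinfun .
lift_definition plus_endo :: "'a endo \<Rightarrow> 'a endo \<Rightarrow> 'a endo" is "(+)" .
lift_definition minus_endo :: "'a endo \<Rightarrow> 'a endo \<Rightarrow> 'a endo" is "(-)" .
lift_definition uminus_endo :: "'a endo \<Rightarrow> 'a endo" is uminus .
lift_definition times_endo :: "'a endo \<Rightarrow> 'a endo \<Rightarrow> 'a endo" is "(o\<^sub>L)" .
lift_definition scaleR_endo :: "real \<Rightarrow> 'a endo \<Rightarrow> 'a endo" is "(*\<^sub>R)" .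
lift_definition norm_endo :: "'a endo \<Rightarrow> real" is norm .

definition dist_endo :: "'a endo \<Rightarrow> 'a endo \<Rightarrow> real" where "dist_endo a b = norm (a - b)"
definition sgn_endo :: "'a endo \<Rightarrow> 'a endo" where "sgn_endo a = inverse (norm a) *\<^sub>R a"
definition uniformity_endo :: "('a endo \<times> 'a endo) filter" where
  "uniformity_endo = (INF e\<in>{0 <..}. principal {(x, y). dist x y < e})"
definition open_endo :: "'a endo set \<Rightarrow> bool" where
  "open_endo U \<longleftrightarrow> (\<forall>x\<in>U. \<forall>\<^sub>F (x', y) in uniformity. x' = x \<longrightarrow> y \<in> U)"

instance
proof
  fix a b c :: "'a endo" and r s :: real
  show "dist a b = norm (a - b)" by (rule dist_endo_def)
  show "sgn a = inverse (norm a) *\<^sub>R a" by (rule sgn_endo_def)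
  show "(0::'a endo) \<noteq> 1"
    by transfer (metis norm_blinfun_id norm_zero zero_neq_one)
  show "(norm a = 0) = (a = 0)" by transfer simp
  show "norm (a + b) \<le> norm a + norm b" by transfer (rule norm_triangle_ineq)
  show "norm (r *\<^sub>R a) = \<bar>r\<bar> * norm a" by transfer simp
  show "norm (a * b) \<le> norm a * norm b" by transfer (rule norm_blinfun_compose)
  show "norm (1::'a endo) = 1" by transfer simp
qed (rule uniformity_endo_def open_endo_def |
     (transfer; simp add: algebra_simps; fail) |
     (transfer; rule blinfun_eqI; simp add: blinfun.add_left blinfun.add_right blinfun.scaleR_left blinfun.scaleR_right; fail))+

end

instance endo :: (euclidean_space) banach
proof
  fix X :: "nat \<Rightarrow> 'a endo" assume "Cauchy X"
  then have "Cauchy (\<lambda>n. Rep_endo (X n))"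
    by (simp add: Cauchy_def dist_norm norm_endo.rep_eq minus_endo.rep_eq)
  then obtain L where "(\<lambda>n. Rep_endo (X n)) \<longlonglongrightarrow> L" using Cauchy_convergent convergent_def by blast
  then have "X \<longlonglongrightarrow> Abs_endo L"
    by (simp add: LIMSEQ_iff norm_endo.rep_eq minus_endo.rep_eq Abs_endo_inverse)
  then show "convergent X" by (auto simp: convergent_def)
qed

lemma bounded_linear_Rep_endo: "bounded_linear Rep_endo"
  by (rule bounded_linear_intro[where K=1])
     (simp_all add: plus_endo.rep_eq scaleR_endo.rep_eq norm_endo.rep_eq)

definition flow_back :: "('a::euclidean_space \<Rightarrow>\<^sub>L 'a) \<Rightarrow> real \<Rightarrow> ('a \<Rightarrow>\<^sub>L 'a)" where
  "flow_back A s = Rep_endo (exp (s *\<^sub>R (- Abs_endo A)))"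

lemma flow_back_0 [simp]: "flow_back A 0 = id_blinfun"
  by (simp add: flow_back_def one_endo.rep_eq)

lemma Rep_endo_uminus_Abs: "Rep_endo (- Abs_endo A) = - A"
  by (simp add: uminus_endo.rep_eq Abs_endo_inverse)

lemma flow_back_deriv: "(flow_back A has_vector_derivative - (flow_back A s o\<^sub>L A)) (at s)"
proof -
  have "((\<lambda>s. Rep_endo (exp (s *\<^sub>R (- Abs_endo A)))) has_vector_derivative
      Rep_endo (exp (s *\<^sub>R (- Abs_endo A)) * (- Abs_endo A))) (at s)"
    by (intro bounded_linear.has_vector_derivative[OF bounded_linear_Rep_endo] exp_scaleR_has_vector_derivative_right)
  moreover have "Rep_endo (exp (s *\<^sub>R (- Abs_endo A)) * (- Abs_endo A)) = - (flow_back A s o\<^sub>L A)"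
    by (simp add: flow_back_def times_endo.rep_eq Rep_endo_uminus_Abs
        bounded_bilinear.minus_right[OF bounded_bilinear_blinfun_compose] del: mult_minus_right)
  ultimately show ?thesis by (simp add: flow_back_def[abs_def])
qed

lemma flow_back_commute: "flow_back A s o\<^sub>L A = A o\<^sub>L flow_back A s"
proof -
  have "exp (s *\<^sub>R (- Abs_endo A)) * (- Abs_endo A) = (- Abs_endo A) * exp (s *\<^sub>R (- Abs_endo A))"
    by (rule exp_times_scaleR_commute)
  then have "Rep_endo (exp (s *\<^sub>R (- Abs_endo A)) * (- Abs_endo A)) = Rep_endo ((- Abs_endo A) * exp (s *\<^sub>R (- Abs_endo A)))"
    by simp
  then show ?thesis
    by (simp add: flow_back_def times_endo.rep_eq Rep_endo_uminus_Abs
        bounded_bilinear.minus_right[OF bounded_bilinear_blinfun_compose]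
        bounded_bilinear.minus_left[OF bounded_bilinear_blinfun_compose] del: mult_minus_right mult_minus_left)
qed

lemma flow_back_inverse: "flow_back A (- s) (flow_back A s v) = v"
proof -
  let ?X = "s *\<^sub>R (- Abs_endo A)"
  have "exp (- ?X) * exp ?X = 1" by (metis exp_minus_inverse minus_minus)
  then have "Rep_endo (exp (- ?X) * exp ?X) = id_blinfun" by (simp add: one_endo.rep_eq)
  then have "flow_back A (- s) o\<^sub>L flow_back A s = id_blinfun"
    by (simp add: flow_back_def times_endo.rep_eq)
  then show ?thesis by (metis blinfun_apply_blinfun_compose blinfun_apply_id_blinfun)
qed

lemma flow_back_inverse': "flow_back A s (flow_back A (- s) v) = v"
  using flow_back_inverse[of A "- s" v] by simp

lemma continuous_on_flow_back [continuous_intros]: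
  "continuous_on S f \<Longrightarrow> continuous_on S (\<lambda>x. flow_back A (f x))"
proof -
  have "continuous_on UNIV (flow_back A)"
    using flow_back_deriv by (auto intro!: continuous_at_imp_continuous_on has_vector_derivative_continuous)
  then show "continuous_on S f \<Longrightarrow> continuous_on S (\<lambda>x. flow_back A (f x))"
    by (rule continuous_on_compose2) auto
qed

lemma flow_back_apply_deriv:
  "((\<lambda>s. flow_back A s v) has_vector_derivative - flow_back A s (A v)) (at s)"
  using bounded_linear.has_vector_derivative[OF blinfun.bounded_linear_left flow_back_deriv]
  by (simp add: blinfun.minus_left)

section \<open>Attainable sets and their support function\<close>

lemma countable_if_isolated:
  fixes S :: "'a::second_countable_topology set"
  assumes "\<And>x. x \<in> S \<Longrightarrow> \<exists>U. open U \<and> x \<in> U \<and> U \<inter> S \<subseteq> {x}"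
  shows "countable S"
proof -
  obtain \<B> :: "'a set set" where \<B>: "countable \<B>" "topological_basis \<B>" using ex_countable_basis by blast
  have "\<exists>V\<in>\<B>. V \<inter> S = {x}" if "x \<in> S" for x
  proof -
    obtain U where "open U" "x \<in> U" "U \<inter> S \<subseteq> {x}" using assms[OF \<open>x \<in> S\<close>] by blast
    moreover then obtain V where "V \<in> \<B>" "x \<in> V" "V \<subseteq> U" using \<B>(2) topological_basisE by blast
    ultimately show ?thesis using that by (intro bexI[of _ V]) auto
  qed
  then obtain f where f: "\<And>x. x \<in> S \<Longrightarrow> f x \<in> \<B> \<and> f x \<inter> S = {x}" by metis
  then have "inj_on f S" by (intro inj_onI) (metis singleton_inject)
  moreover have "f ` S \<subseteq> \<B>" using f by auto
  ultimately show ?thesis using \<B>(1) by (metis countable_image_inj_on countable_subset)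
qed

lemma countable_zeros_with_nonzero_derivative:
  fixes f f' :: "real \<Rightarrow> real"
  assumes "\<And>s. (f has_real_derivative f' s) (at s)"
  shows "countable {s. f s = 0 \<and> f' s \<noteq> 0}"
proof (rule countable_if_isolated)
  fix s assume s: "s \<in> {s. f s = 0 \<and> f' s \<noteq> 0}"
  have "((\<lambda>y. (f y - f s) / (y - s)) \<longlongrightarrow> f' s) (at s)"
    using assms[of s] by (simp add: has_field_derivative_iff)
  then have "\<forall>\<^sub>F y in at s. (f y - f s) / (y - s) \<noteq> 0"
    using s by (intro tendsto_imp_eventually_ne) auto
  then obtain U where "open U" "s \<in> U" "\<And>y. y \<in> U \<Longrightarrow> y \<noteq> s \<Longrightarrow> (f y - f s) / (y - s) \<noteq> 0"
    unfolding eventually_at_topological by blast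
  then show "\<exists>U. open U \<and> s \<in> U \<and> U \<inter> {s. f s = 0 \<and> f' s \<noteq> 0} \<subseteq> {s}"
    using s by (intro exI[of _ U]) auto
qed

text \<open>At every zero, climbing to a nonvanishing derivative passes some order that vanishes
  while the next does not. For each order such points are isolated, so they are countable.\<close>

lemma countable_zeros_of_derivative_chain:
  fixes F :: "nat \<Rightarrow> real \<Rightarrow> real"
  assumes deriv: "\<And>k s. (F k has_real_derivative F (Suc k) s) (at s)"
    and nonzero: "\<And>s. \<exists>k. F k s \<noteq> 0"
  shows "countable {s. F 0 s = 0}"
proof -
  have "{s. F 0 s = 0} \<subseteq> (\<Union>k. {s. F k s = 0 \<and> F (Suc k) s \<noteq> 0})"
  proof
    fix s assume "s \<in> {s. F 0 s = 0}"
    moreover obtain n where "F n s \<noteq> 0" using nonzero by blast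
    ultimately obtain k where "F k s = 0" "F (Suc k) s \<noteq> 0"
      using dec_induct[of 0 n "\<lambda>k. F k s = 0"] by auto
    then show "s \<in> (\<Union>k. {s. F k s = 0 \<and> F (Suc k) s \<noteq> 0})" by blast
  qed
  moreover have "countable (\<Union>k. {s. F k s = 0 \<and> F (Suc k) s \<noteq> 0})"
    using countable_zeros_with_nonzero_derivative[OF deriv] by blast
  ultimately show ?thesis by (rule countable_subset)
qed

text \<open>Compactness of the unit sphere. Applied to differences of support functions, it turns
  strict inequality in each direction into room for a ball.\<close>

lemma homogeneous_bound_below:
  fixes f :: "'a::euclidean_space \<Rightarrow> real"
  assumes cont: "continuous_on UNIV f" and pos: "\<And>z. z \<noteq> 0 \<Longrightarrow> 0 < f z"
    and hom: "\<And>c z. 0 \<le> c \<Longrightarrow> f (c *\<^sub>R z) = c * f z"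
  obtains c where "0 < c" "\<And>z. c * norm z \<le> f z"
proof -
  have "sphere (0::'a) 1 \<noteq> {}" by simp
  then obtain m where m: "m \<in> sphere 0 1" "\<And>z. z \<in> sphere 0 1 \<Longrightarrow> f m \<le> f z"
    using continuous_attains_inf[OF compact_sphere, of "0::'a" 1 f] continuous_on_subset[OF cont] by auto
  show ?thesis
  proof (rule that[of "f m"])
    show "0 < f m" using m by (intro pos) auto
    fix z :: 'a
    show "f m * norm z \<le> f z"
    proof (cases "z = 0")
      case True
      then show ?thesis using hom[of 0 0] by simp
    next
      case False
      have "f m * norm z \<le> f (z /\<^sub>R norm z) * norm z" using False by (intro mult_right_mono m) auto
      also have "\<dots> = f (norm z *\<^sub>R (z /\<^sub>R norm z))" by (simp only: hom[OF norm_ge_zero] mult.commute)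
      finally show ?thesis using False by simp
    qed
  qed
qed

lemma blinfun_apply_matrix: "blinfun_apply (Blinfun ((*v) A)) v = A *v v"
  for A :: "real^'n^'m"
  by (simp add: bounded_linear_Blinfun_apply matrix_vector_mul_bounded_linear)

lemma matrix_vector_mult_columns: "B *v u = (\<Sum>j\<in>UNIV. u $ j *\<^sub>R column j B)"
  for B :: "real^'m^'n"
  by (simp add: matrix_mult_sum scalar_mult_eq_scaleR)

locale linear_system =
  fixes A :: "real^'n^'n" and B :: "real^'m^'n"
begin

definition inv_flow :: "real \<Rightarrow> (real^'n) \<Rightarrow>\<^sub>L (real^'n)" where
  "inv_flow = flow_back (Blinfun ((*v) A))"

text \<open>The vector \<open>exp (- s A) b\<close>, for \<open>b\<close> the \<open>j\<close>-th
  column: up to sign, the shift of the initial point that control \<open>j\<close> compensates by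
  acting at time \<open>s\<close>.\<close>

definition input_dir :: "'m \<Rightarrow> real \<Rightarrow> real^'n" where
  "input_dir j s = inv_flow s (column j B)"

text \<open>The support function of the set of points that can be steered to \<open>0\<close> in time \<open>t\<close>.\<close>

definition supp :: "real \<Rightarrow> real^'n \<Rightarrow> real" where
  "supp t z = integral {0..t} (\<lambda>s. \<Sum>j\<in>UNIV. \<bar>z \<bullet> input_dir j s\<bar>)"

text \<open>Defined dually, so that closedness and convexity are immediate and no compactness of the
  set of controls is invoked. Its link with steering goes through interiors only; under normality it
  is \<open>{T \<le> t}\<close> for \<open>t \<ge> 0\<close>.\<close>

definition reach :: "real \<Rightarrow> (real^'n) set" where
  "reach t = {x. \<forall>z. z \<bullet> x \<le> supp t z}"

lemma inv_flow_apply_deriv: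
  "((\<lambda>s. inv_flow s v) has_vector_derivative - inv_flow s (A *v v)) (at s)"
  using flow_back_apply_deriv[of "Blinfun ((*v) A)" v s] by (simp add: inv_flow_def blinfun_apply_matrix)

lemma continuous_on_inv_flow [continuous_intros]:
  "continuous_on S f \<Longrightarrow> continuous_on S (\<lambda>x. inv_flow (f x))"
  unfolding inv_flow_def by (rule continuous_on_flow_back)

lemma continuous_on_input_dir [continuous_intros]:
  "continuous_on S f \<Longrightarrow> continuous_on S (\<lambda>x. input_dir j (f x))"
  unfolding input_dir_def by (intro continuous_intros)

lemma integrable_supp: "(\<lambda>s. \<Sum>j\<in>UNIV. \<bar>z \<bullet> input_dir j s\<bar>) integrable_on {a..b}"
  by (intro integrable_continuous_real continuous_intros)

lemma supp_split:
  assumes "0 \<le> s" "s \<le> t"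
  shows "supp t z = supp s z + integral {s..t} (\<lambda>s. \<Sum>j\<in>UNIV. \<bar>z \<bullet> input_dir j s\<bar>)"
  unfolding supp_def using Henstock_Kurzweil_Integration.integral_combine[OF assms integrable_supp] by simp

lemma supp_mono: "0 \<le> s \<Longrightarrow> s \<le> t \<Longrightarrow> supp s z \<le> supp t z"
  using supp_split[of s t z] integral_nonneg[OF integrable_supp, of s t z] by (simp add: sum_nonneg)

lemma supp_0 [simp]: "supp 0 z = 0"
  by (simp add: supp_def)

lemma scaled_dual_abs: "(\<Sum>j\<in>UNIV. \<bar>(c *\<^sub>R z) \<bullet> input_dir j s\<bar>) = \<bar>c\<bar> * (\<Sum>j\<in>UNIV. \<bar>z \<bullet> input_dir j s\<bar>)"
  by (simp add: sum_distrib_left abs_mult)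

lemma supp_scaleR: "supp t (c *\<^sub>R z) = \<bar>c\<bar> * supp t z"
  unfolding supp_def scaled_dual_abs by simp

lemma continuous_on_window_supp:
  "continuous_on UNIV (\<lambda>z. integral {a..b} (\<lambda>s. \<Sum>j\<in>UNIV. \<bar>z \<bullet> input_dir j s\<bar>))"
proof -
  have "continuous_on UNIV (\<lambda>z. integral (cbox a b) (\<lambda>s. \<Sum>j\<in>UNIV. \<bar>z \<bullet> input_dir j s\<bar>))"
    by (rule integral_continuous_on_param) (auto simp: split_beta intro!: continuous_intros)
  then show ?thesis by simp
qed

text \<open>Lipschitz dependence on time, uniform over directions. It serves to pass to limits in
  the horizon and to trade slack in the support inequality for a shorter time.\<close>

lemma supp_increment_bound:
  assumes "0 \<le> t"
  obtains M where "0 < M" "\<And>s t' z. 0 \<le> s \<Longrightarrow> s \<le> t' \<Longrightarrow> t' \<le> t \<Longrightarrow> supp t' z \<le> supp s z + M * (t' - s) * norm z"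
proof -
  have "continuous_on {0..t} (\<lambda>s. \<Sum>j\<in>UNIV. norm (input_dir j s))" by (intro continuous_intros)
  then have "bounded ((\<lambda>s. \<Sum>j\<in>UNIV. norm (input_dir j s)) ` {0..t})"
    by (intro compact_imp_bounded compact_continuous_image) auto
  then obtain M where M: "\<forall>s\<in>{0..t}. \<bar>\<Sum>j\<in>UNIV. norm (input_dir j s)\<bar> \<le> M" by (auto simp: bounded_iff)
  show ?thesis
  proof (rule that[of "max M 1"])
    fix s t' z assume st: "0 \<le> s" "s \<le> t'" "t' \<le> t"
    have "integral {s..t'} (\<lambda>s. \<Sum>j\<in>UNIV. \<bar>z \<bullet> input_dir j s\<bar>) \<le> integral {s..t'} (\<lambda>s. max M 1 * norm z)"
    proof (rule integral_le[OF integrable_supp])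
      fix r assume r: "r \<in> {s..t'}"
      have "(\<Sum>j\<in>UNIV. \<bar>z \<bullet> input_dir j r\<bar>) \<le> (\<Sum>j\<in>UNIV. norm z * norm (input_dir j r))"
        by (intro sum_mono Cauchy_Schwarz_ineq2)
      also have "\<dots> = norm z * (\<Sum>j\<in>UNIV. norm (input_dir j r))" by (simp add: sum_distrib_left)
      also have "\<dots> \<le> norm z * max M 1" using M[rule_format, of r] r st by (intro mult_left_mono) auto
      finally show "(\<Sum>j\<in>UNIV. \<bar>z \<bullet> input_dir j r\<bar>) \<le> max M 1 * norm z" by (simp add: mult.commute)
    qed (intro integrable_continuous_real continuous_intros)
    then show "supp t' z \<le> supp s z + max M 1 * (t' - s) * norm z"
      using supp_split[of s t' z] st by (simp add: mult_ac)
  qed simp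
qed

lemma closed_reach: "closed (reach t)"
  unfolding reach_def Collect_all_eq by (intro closed_INT ballI closed_Collect_le continuous_intros)

lemma convex_reach: "convex (reach t)"
proof -
  have "reach t = (\<Inter>z. {x. z \<bullet> x \<le> supp t z})" by (auto simp: reach_def)
  then show ?thesis by (simp add: convex_INT convex_halfspace_le)
qed

lemma reach_mono: "0 \<le> s \<Longrightarrow> s \<le> t \<Longrightarrow> reach s \<subseteq> reach t"
  unfolding reach_def using supp_mono order_trans by blast

lemma bounded_reach: "bounded (reach t)"
proof -
  have "norm x \<le> (\<Sum>i\<in>Basis. supp t i)" if "x \<in> reach t" for x
  proof -
    have "\<bar>x \<bullet> i\<bar> \<le> supp t i" for i
    proof -
      have "i \<bullet> x \<le> supp t i" "(- i) \<bullet> x \<le> supp t (- i)" using that unfolding reach_def by blast+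
      moreover have "supp t (- i) = supp t i" using supp_scaleR[of t "-1" i] by simp
      ultimately show ?thesis by (simp add: inner_commute abs_le_iff)
    qed
    then show ?thesis using norm_le_l1[of x] by (meson order_trans sum_mono)
  qed
  then show ?thesis unfolding bounded_iff by blast
qed

end

text \<open>The product rule at a zero of \<open>f\<close>, where continuity of \<open>g\<close>
  suffices. The factor \<open>g\<close> will be a coordinate of the trajectory, which need not be
  differentiable at the given time.\<close>

lemma has_real_derivative_vanishing_mult:
  fixes f g :: "real \<Rightarrow> real"
  assumes f: "(f has_real_derivative f') (at s within S)" and "f s = 0"
    and g: "continuous (at s within S) g"
  shows "((\<lambda>r. f r * g r) has_real_derivative f' * g s) (at s within S)"
proof -
  have "((\<lambda>y. (f y - f s) / (y - s) * g y) \<longlongrightarrow> f' * g s) (at s within S)"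
    using f g by (intro tendsto_mult) (auto simp: has_field_derivative_iff continuous_within)
  then show ?thesis unfolding has_field_derivative_iff using \<open>f s = 0\<close> by simp
qed

section \<open>Steering to the origin compared with the support function\<close>

context linear_system
begin

lemma input_eq: "z \<bullet> inv_flow s (B *v u) = (\<Sum>j\<in>UNIV. u $ j * (z \<bullet> input_dir j s))"
  by (simp add: matrix_vector_mult_columns blinfun.sum_right blinfun.scaleR_right inner_sum_right input_dir_def)

text \<open>The trajectory \<open>x\<close> is merely absolutely continuous, but the difference of the two sides, as a
  function of the final time, is differentiable everywhere with derivative zero.\<close>

lemma variation_of_constants:
  assumes u: "u \<in> borel_measurable (lebesgue_on {0..\<theta>})" and bound: "\<And>t j. t \<in> {0..\<theta>} \<Longrightarrow> \<bar>u t $ j\<bar> \<le> 1"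
    and int: "(\<lambda>s. A *v x s + B *v u s) integrable_on {0..\<theta>}"
    and x: "\<And>t. t \<in> {0..\<theta>} \<Longrightarrow> x t = x0 + integral {0..t} (\<lambda>s. A *v x s + B *v u s)"
    and "0 \<le> \<theta>"
  shows "(\<lambda>s. z \<bullet> inv_flow s (B *v u s)) integrable_on {0..\<theta>}"
    and "z \<bullet> inv_flow \<theta> (x \<theta>) = z \<bullet> x0 + integral {0..\<theta>} (\<lambda>s. z \<bullet> inv_flow s (B *v u s))"
proof -
  let ?I = "{0..\<theta>}"
  define g where "g s = A *v x s + B *v u s" for s
  define k where "k s = z \<bullet> inv_flow s (B *v u s)" for s
  have "continuous_on ?I (\<lambda>t. x0 + integral {0..t} g)"
    using int unfolding g_def by (intro continuous_intros indefinite_integral_continuous_1)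
  then have xc: "continuous_on ?I x"
    using x unfolding g_def by (subst continuous_on_cong[OF refl, of _ x]) auto
  have meas: "(\<lambda>s. \<Sum>j\<in>UNIV. u s $ j * f j s) \<in> borel_measurable (lebesgue_on ?I)"
    if "\<And>j. continuous_on UNIV (f j)" for f :: "'m \<Rightarrow> real \<Rightarrow> real"
  proof (intro borel_measurable_sum borel_measurable_times)
    fix j
    have "(\<lambda>s. u s \<bullet> axis j 1) \<in> borel_measurable (lebesgue_on ?I)" using u by measurable
    then show "(\<lambda>s. u s $ j) \<in> borel_measurable (lebesgue_on ?I)" by (simp add: cart_eq_inner_axis)
    show "f j \<in> borel_measurable (lebesgue_on ?I)"
      using continuous_imp_measurable_on_sets_lebesgue[of ?I "f j"] continuous_on_subset[OF that] by auto
  qed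
  have le: "\<bar>\<Sum>j\<in>UNIV. u s $ j * f j s\<bar> \<le> (\<Sum>j\<in>UNIV. \<bar>f j s\<bar>)" if "s \<in> ?I" for s and f :: "'m \<Rightarrow> real \<Rightarrow> real"
  proof -
    have "\<bar>\<Sum>j\<in>UNIV. u s $ j * f j s\<bar> \<le> (\<Sum>j\<in>UNIV. \<bar>u s $ j * f j s\<bar>)" by (rule sum_abs)
    also have "\<dots> \<le> (\<Sum>j\<in>UNIV. \<bar>f j s\<bar>)"
      using bound[OF that] by (intro sum_mono) (auto simp: abs_mult intro: mult_left_le_one_le)
    finally show ?thesis .
  qed
  have intf: "(\<lambda>s. \<Sum>j\<in>UNIV. u s $ j * f j s) integrable_on ?I"
    if c: "\<And>j. continuous_on UNIV (f j)" for f :: "'m \<Rightarrow> real \<Rightarrow> real"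
  proof (rule measurable_bounded_by_integrable_imp_integrable_real[OF meas[OF c]])
    show "(\<lambda>s. \<Sum>j\<in>UNIV. \<bar>f j s\<bar>) integrable_on ?I"
      by (intro integrable_continuous_real continuous_intros continuous_on_subset[OF c]) auto
  qed (use le in auto)
  have kint: "k integrable_on ?I" unfolding k_def input_eq by (intro intf continuous_intros)
  then show "(\<lambda>s. z \<bullet> inv_flow s (B *v u s)) integrable_on ?I" by (simp add: k_def[abs_def])
  define F where "F s = z \<bullet> inv_flow s (x s) - integral {0..s} k" for s
  have "(F has_real_derivative 0) (at s0 within ?I)" if s0: "s0 \<in> ?I" for s0
  proof -
    \<comment> \<open>Freezing the flow at \<open>s0\<close> makes the coefficient of each control
      component tend to 0 as \<open>r\<close> tends to \<open>s0\<close>. The control is bounded, so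
      \<open>q\<close> is continuous at \<open>s0\<close> even if the control is not, and its
      integral is differentiable there.\<close>
    define q where "q r = z \<bullet> inv_flow s0 (g r) - k r" for r
    have gint: "g integrable_on ?I" using int by (simp add: g_def[abs_def])
    have bl: "bounded_linear (\<lambda>v. z \<bullet> inv_flow s0 v)"
      by (intro bounded_linear_inner_right_comp blinfun.bounded_linear_right)
    have lin_int: "(\<lambda>r. z \<bullet> inv_flow s0 (g r)) integrable_on ?I"
      using integrable_linear[OF gint bl] by (simp add: o_def)
    have qint: "q integrable_on ?I" unfolding q_def by (intro integrable_diff lin_int kint)
    have q_eq: "q r = z \<bullet> inv_flow s0 (A *v x r) + (\<Sum>j\<in>UNIV. u r $ j * (z \<bullet> input_dir j s0 - z \<bullet> input_dir j r))" for r
      unfolding q_def k_def g_def input_eq blinfun.add_right inner_add_right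
      by (simp add: sum_subtractf algebra_simps)
    have q_s0: "q s0 = z \<bullet> inv_flow s0 (A *v x s0)" by (simp add: q_eq)
    have "(q \<longlongrightarrow> q s0) (at s0 within ?I)"
    proof -
      have "((\<lambda>r. z \<bullet> inv_flow s0 (A *v x r)) \<longlongrightarrow> z \<bullet> inv_flow s0 (A *v x s0)) (at s0 within ?I)"
        using xc s0 unfolding continuous_on_def
        by (intro tendsto_intros bounded_linear.tendsto[OF matrix_vector_mul_bounded_linear]) auto
      moreover have "((\<lambda>r. \<Sum>j\<in>UNIV. u r $ j * (z \<bullet> input_dir j s0 - z \<bullet> input_dir j r)) \<longlongrightarrow> 0) (at s0 within ?I)"
      proof (rule Lim_null_comparison)
        show "\<forall>\<^sub>F r in at s0 within ?I. norm (\<Sum>j\<in>UNIV. u r $ j * (z \<bullet> input_dir j s0 - z \<bullet> input_dir j r))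
            \<le> (\<Sum>j\<in>UNIV. \<bar>z \<bullet> input_dir j s0 - z \<bullet> input_dir j r\<bar>)"
          unfolding eventually_at_filter using le[where f="\<lambda>j r. z \<bullet> input_dir j s0 - z \<bullet> input_dir j r"] by simp
        have "continuous_on UNIV (\<lambda>r. \<Sum>j\<in>UNIV. \<bar>z \<bullet> input_dir j s0 - z \<bullet> input_dir j r\<bar>)" by (intro continuous_intros)
        then have "((\<lambda>r. \<Sum>j\<in>UNIV. \<bar>z \<bullet> input_dir j s0 - z \<bullet> input_dir j r\<bar>) \<longlongrightarrow> (\<Sum>j\<in>UNIV. \<bar>z \<bullet> input_dir j s0 - z \<bullet> input_dir j s0\<bar>)) (at s0)"
          unfolding continuous_on_def by (rule bspec) simp
        then show "((\<lambda>r. \<Sum>j\<in>UNIV. \<bar>z \<bullet> input_dir j s0 - z \<bullet> input_dir j r\<bar>) \<longlongrightarrow> 0) (at s0 within ?I)"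
          using Lim_at_imp_Lim_at_within by fastforce
      qed
      ultimately have "((\<lambda>r. z \<bullet> inv_flow s0 (A *v x r) + (\<Sum>j\<in>UNIV. u r $ j * (z \<bullet> input_dir j s0 - z \<bullet> input_dir j r)))
          \<longlongrightarrow> z \<bullet> inv_flow s0 (A *v x s0) + 0) (at s0 within ?I)" by (rule tendsto_add)
      then show ?thesis by (simp only: q_eq[symmetric] q_s0 add_0_right)
    qed
    then have "continuous (at s0 within ?I - {}) q" by (simp add: continuous_within)
    from integral_has_vector_derivative_continuous_at[OF qint _ _ this] s0
    have d1: "((\<lambda>s. integral {0..s} q) has_real_derivative q s0) (at s0 within ?I)"
      by (simp add: has_real_derivative_iff_has_vector_derivative)
    \<comment> \<open>The increment of the flow, taken coordinatewise, vanishes at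
      \<open>s0\<close>, so this derivative needs only continuity of \<open>x\<close>. It is
      \<open>- q s0\<close> and cancels the derivative of the integral.\<close>
    have d2: "((\<lambda>s. \<Sum>i\<in>Basis. (z \<bullet> inv_flow s i - z \<bullet> inv_flow s0 i) * (x s \<bullet> i))
        has_real_derivative (\<Sum>i\<in>Basis. - (z \<bullet> inv_flow s0 (A *v i)) * (x s0 \<bullet> i))) (at s0 within ?I)"
    proof (rule DERIV_sum)
      fix i :: "real^'n"
      show "((\<lambda>s. (z \<bullet> inv_flow s i - z \<bullet> inv_flow s0 i) * (x s \<bullet> i)) has_real_derivative
          - (z \<bullet> inv_flow s0 (A *v i)) * (x s0 \<bullet> i)) (at s0 within ?I)"
      proof (rule has_real_derivative_vanishing_mult)
        have "((\<lambda>s. z \<bullet> inv_flow s i) has_vector_derivative z \<bullet> - inv_flow s0 (A *v i)) (at s0)"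
          by (rule bounded_linear.has_vector_derivative[OF bounded_linear_inner_right inv_flow_apply_deriv])
        then have "((\<lambda>s. z \<bullet> inv_flow s i) has_real_derivative - (z \<bullet> inv_flow s0 (A *v i))) (at s0 within ?I)"
          by (simp add: has_real_derivative_iff_has_vector_derivative has_vector_derivative_at_within)
        then show "((\<lambda>s. z \<bullet> inv_flow s i - z \<bullet> inv_flow s0 i) has_real_derivative - (z \<bullet> inv_flow s0 (A *v i))) (at s0 within ?I)"
          using DERIV_diff[OF _ DERIV_const, of "\<lambda>s. z \<bullet> inv_flow s i"] by simp
        show "continuous (at s0 within ?I) (\<lambda>s. x s \<bullet> i)"
          using xc s0 by (intro continuous_intros) (simp add: continuous_on_eq_continuous_within)
      qed simp
    qed
    have expand: "z \<bullet> L v = (\<Sum>i\<in>Basis. (z \<bullet> L i) * (v \<bullet> i))" if "linear L" for L :: "real^'n \<Rightarrow> real^'n" and v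
    proof -
      have "L v = (\<Sum>i\<in>Basis. (v \<bullet> i) *\<^sub>R L i)"
        using that by (metis (no_types, lifting) euclidean_representation linear_scale linear_sum sum.cong)
      then show ?thesis by (simp add: inner_sum_right mult.commute)
    qed
    have sum_eq: "(\<Sum>i\<in>Basis. (z \<bullet> inv_flow s i - z \<bullet> inv_flow s0 i) * (x s \<bullet> i)) = z \<bullet> inv_flow s (x s) - z \<bullet> inv_flow s0 (x s)" for s
      using expand[of "blinfun_apply (inv_flow s)" "x s"] expand[of "blinfun_apply (inv_flow s0)" "x s"]
      by (simp add: left_diff_distrib sum_subtractf blinfun.bounded_linear_right bounded_linear.linear)
    have "linear (\<lambda>v. inv_flow s0 (A *v v))"
      using linear_compose[of "(*v) A" "blinfun_apply (inv_flow s0)"]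
      by (simp add: o_def matrix_vector_mul_linear blinfun.bounded_linear_right bounded_linear.linear)
    from expand[OF this, of "x s0"]
    have sum_eq': "(\<Sum>i\<in>Basis. - (z \<bullet> inv_flow s0 (A *v i)) * (x s0 \<bullet> i)) = - q s0"
      by (simp add: q_s0 sum_negf)
    have D: "((\<lambda>s. z \<bullet> inv_flow s0 x0 + (z \<bullet> inv_flow s (x s) - z \<bullet> inv_flow s0 (x s)) + integral {0..s} q)
        has_real_derivative 0 + (- q s0) + q s0) (at s0 within ?I)"
      by (intro DERIV_add DERIV_const d1 d2[unfolded sum_eq sum_eq'])
    have F_eq: "z \<bullet> inv_flow s0 x0 + (z \<bullet> inv_flow s (x s) - z \<bullet> inv_flow s0 (x s)) + integral {0..s} q = F s"
      if s: "s \<in> ?I" for s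
    proof -
      have sub: "{0..s} \<subseteq> ?I" using s by auto
      have ints: "g integrable_on {0..s}" "(\<lambda>r. z \<bullet> inv_flow s0 (g r)) integrable_on {0..s}" "k integrable_on {0..s}"
        using integrable_on_subinterval[OF gint sub] integrable_on_subinterval[OF lin_int sub]
          integrable_on_subinterval[OF kint sub] by auto
      have "integral {0..s} q = z \<bullet> inv_flow s0 (integral {0..s} g) - integral {0..s} k"
        unfolding q_def using integral_linear[OF ints(1) bl] by (simp add: integral_diff[OF ints(2,3)] o_def)
      moreover have "x s = x0 + integral {0..s} g" using x[OF s] by (simp add: g_def[abs_def])
      ultimately show ?thesis by (simp add: F_def blinfun.add_right inner_add_right)
    qed
    show ?thesis
      using has_field_derivative_transform_within[OF D, of 1 F] F_eq s0 by simp
  qed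
  then obtain c where c: "\<And>s. s \<in> ?I \<Longrightarrow> F s = c"
    using has_field_derivative_zero_constant[of ?I F] by auto
  have "F \<theta> = F 0" using c[of 0] c[of \<theta>] \<open>0 \<le> \<theta>\<close> by simp
  moreover have "x 0 = x0" using x[of 0] \<open>0 \<le> \<theta>\<close> by simp
  ultimately show "z \<bullet> inv_flow \<theta> (x \<theta>) = z \<bullet> x0 + integral ?I (\<lambda>s. z \<bullet> inv_flow s (B *v u s))"
    by (simp add: F_def k_def[abs_def] inv_flow_def)
qed

lemma steers_imp_reach:
  assumes "steers_to_zero A B x0 \<theta>" "0 \<le> \<theta>"
  shows "x0 \<in> reach \<theta>"
proof -
  obtain u x where u: "u \<in> borel_measurable (lebesgue_on {0..\<theta>})" "\<And>t j. t \<in> {0..\<theta>} \<Longrightarrow> \<bar>u t $ j\<bar> \<le> 1"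
    and x: "(\<lambda>s. A *v x s + B *v u s) integrable_on {0..\<theta>}"
      "\<And>t. t \<in> {0..\<theta>} \<Longrightarrow> x t = x0 + integral {0..t} (\<lambda>s. A *v x s + B *v u s)" and "x \<theta> = 0"
    using assms(1) unfolding steers_to_zero_def by blast
  note voc = variation_of_constants[OF u x assms(2)]
  have "z \<bullet> x0 \<le> supp \<theta> z" for z
  proof -
    have "z \<bullet> x0 = integral {0..\<theta>} (\<lambda>s. - (z \<bullet> inv_flow s (B *v u s)))"
      using voc(2)[of z] \<open>x \<theta> = 0\<close> by (simp add: blinfun.zero_right)
    also have "\<dots> \<le> supp \<theta> z"
      unfolding supp_def
    proof (rule integral_le[OF _ integrable_supp])
      show "(\<lambda>s. - (z \<bullet> inv_flow s (B *v u s))) integrable_on {0..\<theta>}" using integrable_neg[OF voc(1)] .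
      fix s assume s: "s \<in> {0..\<theta>}"
      have "- (z \<bullet> inv_flow s (B *v u s)) \<le> \<bar>\<Sum>j\<in>UNIV. u s $ j * (z \<bullet> input_dir j s)\<bar>" unfolding input_eq by linarith
      also have "\<dots> \<le> (\<Sum>j\<in>UNIV. \<bar>u s $ j * (z \<bullet> input_dir j s)\<bar>)" by (rule sum_abs)
      also have "\<dots> \<le> (\<Sum>j\<in>UNIV. \<bar>z \<bullet> input_dir j s\<bar>)"
        using u(2)[OF s] by (intro sum_mono) (auto simp: abs_mult intro: mult_left_le_one_le)
      finally show "- (z \<bullet> inv_flow s (B *v u s)) \<le> (\<Sum>j\<in>UNIV. \<bar>z \<bullet> input_dir j s\<bar>)" .
    qed
    finally show ?thesis .
  qed
  then show ?thesis by (simp add: reach_def)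
qed

lemma convex_steers: "convex {x. steers_to_zero A B x \<theta>}"
proof (rule convexI)
  fix x0 y0 :: "real^'n" and a b :: real
  assume ab: "0 \<le> a" "0 \<le> b" "a + b = 1" and "x0 \<in> {x. steers_to_zero A B x \<theta>}" "y0 \<in> {x. steers_to_zero A B x \<theta>}"
  then have x0: "steers_to_zero A B x0 \<theta>" and y0: "steers_to_zero A B y0 \<theta>" by auto
  obtain u x where
    u: "u \<in> borel_measurable (lebesgue_on {0..\<theta>})" "\<And>t j. t \<in> {0..\<theta>} \<Longrightarrow> \<bar>u t $ j\<bar> \<le> 1"
    and x: "(\<lambda>s. A *v x s + B *v u s) integrable_on {0..\<theta>}"
      "\<And>t. t \<in> {0..\<theta>} \<Longrightarrow> x t = x0 + integral {0..t} (\<lambda>s. A *v x s + B *v u s)" "x \<theta> = 0"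
    using x0 unfolding steers_to_zero_def by blast
  obtain v y where
    v: "v \<in> borel_measurable (lebesgue_on {0..\<theta>})" "\<And>t j. t \<in> {0..\<theta>} \<Longrightarrow> \<bar>v t $ j\<bar> \<le> 1"
    and y: "(\<lambda>s. A *v y s + B *v v s) integrable_on {0..\<theta>}"
      "\<And>t. t \<in> {0..\<theta>} \<Longrightarrow> y t = y0 + integral {0..t} (\<lambda>s. A *v y s + B *v v s)" "y \<theta> = 0"
    using y0 unfolding steers_to_zero_def by blast
  let ?w = "\<lambda>s. a *\<^sub>R u s + b *\<^sub>R v s" and ?z = "\<lambda>s. a *\<^sub>R x s + b *\<^sub>R y s"
  have eq: "A *v ?z s + B *v ?w s = a *\<^sub>R (A *v x s + B *v u s) + b *\<^sub>R (A *v y s + B *v v s)" for s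
    by (simp add: matrix_vector_right_distrib matrix_vector_mult_scaleR algebra_simps)
  show "a *\<^sub>R x0 + b *\<^sub>R y0 \<in> {x. steers_to_zero A B x \<theta>}"
    unfolding steers_to_zero_def mem_Collect_eq
  proof (intro exI[of _ ?w] exI[of _ ?z] conjI ballI allI)
    show "?w \<in> borel_measurable (lebesgue_on {0..\<theta>})" using u v by measurable
    show "(\<lambda>s. A *v ?z s + B *v ?w s) integrable_on {0..\<theta>}"
      unfolding eq by (intro integrable_add integrable_cmul x y)
    show "a *\<^sub>R x \<theta> + b *\<^sub>R y \<theta> = 0" using x y by simp
    fix t assume t: "t \<in> {0..\<theta>}"
    show "\<bar>?w t $ j\<bar> \<le> 1" for j
    proof -
      have "\<bar>?w t $ j\<bar> \<le> a * \<bar>u t $ j\<bar> + b * \<bar>v t $ j\<bar>"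
        using ab abs_triangle_ineq[of "a * u t $ j" "b * v t $ j"] by (simp add: abs_mult)
      also have "\<dots> \<le> a * 1 + b * 1" using ab u(2)[OF t] v(2)[OF t] by (intro add_mono mult_left_mono) auto
      finally show ?thesis using ab by simp
    qed
    have sub: "{0..t} \<subseteq> {0..\<theta>}" using t by auto
    have ints: "(\<lambda>s. A *v x s + B *v u s) integrable_on {0..t}" "(\<lambda>s. A *v y s + B *v v s) integrable_on {0..t}"
      using integrable_on_subinterval[OF x(1) sub] integrable_on_subinterval[OF y(1) sub] by auto
    have "integral {0..t} (\<lambda>s. A *v ?z s + B *v ?w s)
        = a *\<^sub>R integral {0..t} (\<lambda>s. A *v x s + B *v u s) + b *\<^sub>R integral {0..t} (\<lambda>s. A *v y s + B *v v s)"
      unfolding eq using ints by (simp add: integral_add integrable_cmul)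
    then show "?z t = a *\<^sub>R x0 + b *\<^sub>R y0 + integral {0..t} (\<lambda>s. A *v ?z s + B *v ?w s)"
      using x(2)[OF t] y(2)[OF t] by (simp add: scaleR_add_right)
  qed
qed

text \<open>For a continuous control the explicit trajectory is classically differentiable, and the
  initial point is chosen to make it end at 0. Such controls already give a dense part of
  \<open>reach\<close>.\<close>

lemma steers_continuous_control:
  assumes u: "continuous_on UNIV u" "\<And>s j. \<bar>u s $ j\<bar> \<le> 1" and "0 \<le> \<theta>"
  shows "steers_to_zero A B (- integral {0..\<theta>} (\<lambda>s. inv_flow s (B *v u s))) \<theta>" (is "steers_to_zero A B ?x0 \<theta>")
proof -
  define v where "v s = inv_flow s (B *v u s)" for s
  have Bu: "continuous_on S (\<lambda>s. B *v u s)" for S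
    by (intro bounded_linear.continuous_on[OF matrix_vector_mul_bounded_linear] continuous_on_subset[OF u(1)]) auto
  have vc: "continuous_on S v" for S unfolding v_def by (intro continuous_intros Bu)
  define y where "y t = ?x0 + integral {0..t} v" for t
  define x where "x t = inv_flow (- t) (y t)" for t
  have yd: "(y has_vector_derivative v t) (at t within {0..\<theta>})" if "t \<in> {0..\<theta>}" for t
    unfolding y_def using has_vector_derivative_add[OF has_vector_derivative_const integral_has_vector_derivative[OF vc that], of ?x0]
    by simp
  have xd: "(x has_vector_derivative A *v x t + B *v u t) (at t within {0..\<theta>})" if t: "t \<in> {0..\<theta>}" for t
  proof -
    let ?A = "Blinfun ((*v) A)"
    have "(inv_flow has_vector_derivative - (inv_flow (- t) o\<^sub>L ?A)) (at (- t))"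
      unfolding inv_flow_def by (rule flow_back_deriv)
    from has_vector_derivative_at_within[OF vector_diff_chain_at[OF has_vector_derivative_minus[OF has_vector_derivative_id] this]]
    have "((\<lambda>t. inv_flow (- t)) has_vector_derivative inv_flow (- t) o\<^sub>L ?A) (at t within {0..\<theta>})"
      by (simp add: o_def)
    from bounded_bilinear.has_vector_derivative[OF bounded_bilinear_blinfun_apply this yd[OF t]]
    have "(x has_vector_derivative inv_flow (- t) (v t) + (inv_flow (- t) o\<^sub>L ?A) (y t)) (at t within {0..\<theta>})"
      by (simp add: x_def[abs_def])
    moreover have "inv_flow (- t) (v t) = B *v u t" unfolding v_def inv_flow_def by (rule flow_back_inverse)
    moreover have "(inv_flow (- t) o\<^sub>L ?A) (y t) = A *v x t"
      unfolding x_def inv_flow_def flow_back_commute by (simp add: blinfun_apply_matrix)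
    ultimately show ?thesis by (simp add: add.commute)
  qed
  have x0: "x 0 = ?x0" by (simp add: x_def y_def inv_flow_def)
  have hi: "((\<lambda>s. A *v x s + B *v u s) has_integral x t - x 0) {0..t}" if t: "t \<in> {0..\<theta>}" for t
    using t by (intro fundamental_theorem_of_calculus has_vector_derivative_within_subset[OF xd]) auto
  show ?thesis unfolding steers_to_zero_def
  proof (intro exI[of _ u] exI[of _ x] conjI ballI allI)
    show "u \<in> borel_measurable (lebesgue_on {0..\<theta>})"
      using continuous_imp_measurable_on_sets_lebesgue[of "{0..\<theta>}" u] continuous_on_subset[OF u(1)] by auto
    show "(\<lambda>s. A *v x s + B *v u s) integrable_on {0..\<theta>}" using hi[of \<theta>] \<open>0 \<le> \<theta>\<close> by (auto simp: integrable_on_def)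
    show "x t = ?x0 + integral {0..t} (\<lambda>s. A *v x s + B *v u s)" if "t \<in> {0..\<theta>}" for t
      using integral_unique[OF hi[OF that]] x0 by simp
    show "x \<theta> = 0" by (simp add: x_def y_def v_def[abs_def] blinfun.zero_right)
  qed (rule u)
qed

text \<open>The bang-bang control \<open>- sgn (z \<bullet> input_dir j s)\<close> is replaced by a continuous approximation.\<close>

lemma steers_near_support:
  assumes "0 \<le> \<theta>" "0 < \<epsilon>"
  obtains x where "steers_to_zero A B x \<theta>" "supp \<theta> z - \<epsilon> \<le> z \<bullet> x"
proof -
  \<comment> \<open>Smoothing costs at most \<open>d\<close> per component and unit time, in total
    \<open>\<theta> * \<epsilon> / (\<theta> + 1)\<close>, which is at most
    \<open>\<epsilon>\<close>; the added 1 admits \<open>\<theta> = 0\<close>.\<close>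
  define d where "d = \<epsilon> / (real CARD('m) * (\<theta> + 1))"
  have d: "0 < d" using assms by (simp add: d_def)
  define u :: "real \<Rightarrow> real^'m" where "u s = (\<chi> j. - (z \<bullet> input_dir j s) / (\<bar>z \<bullet> input_dir j s\<bar> + d))" for s
  have uc: "continuous_on UNIV u" unfolding u_def using d
    by (intro continuous_on_vec_lambda continuous_intros) (auto simp: add_nonneg_eq_0_iff)
  have ub: "\<bar>u s $ j\<bar> \<le> 1" for s j using d by (auto simp: u_def abs_divide divide_simps)
  let ?x = "- integral {0..\<theta>} (\<lambda>s. inv_flow s (B *v u s))"
  have Bu: "continuous_on S (\<lambda>s. B *v u s)" for S
    by (intro bounded_linear.continuous_on[OF matrix_vector_mul_bounded_linear] continuous_on_subset[OF uc]) auto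
  have ci: "continuous_on S (\<lambda>s. inv_flow s (B *v u s))" for S by (intro continuous_intros Bu)
  have "z \<bullet> ?x = integral {0..\<theta>} (\<lambda>s. - (z \<bullet> inv_flow s (B *v u s)))"
    using integral_linear[OF integrable_continuous_real[OF ci] bounded_linear_inner_right, of 0 \<theta> z] by (simp add: o_def)
  also have "\<dots> \<ge> integral {0..\<theta>} (\<lambda>s. (\<Sum>j\<in>UNIV. \<bar>z \<bullet> input_dir j s\<bar>) - real CARD('m) * d)"
  proof (rule integral_le)
    fix s
    have "(\<Sum>j\<in>UNIV. \<bar>z \<bullet> input_dir j s\<bar>) - real CARD('m) * d = (\<Sum>j\<in>(UNIV::'m set). \<bar>z \<bullet> input_dir j s\<bar> - d)"
      by (simp add: sum_subtractf)
    also have "\<dots> \<le> (\<Sum>j\<in>UNIV. - (u s $ j * (z \<bullet> input_dir j s)))"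
    proof (rule sum_mono)
      fix j
      have "(\<bar>z \<bullet> input_dir j s\<bar> - d) * (\<bar>z \<bullet> input_dir j s\<bar> + d) \<le> (z \<bullet> input_dir j s) * (z \<bullet> input_dir j s)"
        by (simp add: algebra_simps)
      then have "\<bar>z \<bullet> input_dir j s\<bar> - d \<le> (z \<bullet> input_dir j s) * (z \<bullet> input_dir j s) / (\<bar>z \<bullet> input_dir j s\<bar> + d)"
        using d by (subst pos_le_divide_eq) auto
      then show "\<bar>z \<bullet> input_dir j s\<bar> - d \<le> - (u s $ j * (z \<bullet> input_dir j s))" by (simp add: u_def)
    qed
    finally show "(\<Sum>j\<in>UNIV. \<bar>z \<bullet> input_dir j s\<bar>) - real CARD('m) * d \<le> - (z \<bullet> inv_flow s (B *v u s))"
      by (simp add: input_eq sum_negf)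
  qed (intro integrable_continuous_real continuous_intros ci)+
  also have "integral {0..\<theta>} (\<lambda>s. (\<Sum>j\<in>UNIV. \<bar>z \<bullet> input_dir j s\<bar>) - real CARD('m) * d) = supp \<theta> z - \<theta> * (real CARD('m) * d)"
    unfolding supp_def using assms by (subst integral_diff[OF integrable_supp]) auto
  also have "\<theta> * (real CARD('m) * d) = \<theta> * \<epsilon> / (\<theta> + 1)" by (simp add: d_def)
  finally have "supp \<theta> z - \<theta> * \<epsilon> / (\<theta> + 1) \<le> z \<bullet> ?x" .
  moreover have "\<theta> * \<epsilon> / (\<theta> + 1) \<le> \<epsilon>" using assms by (simp add: field_simps)
  ultimately have "supp \<theta> z - \<epsilon> \<le> z \<bullet> ?x" by linarith
  then show ?thesis using steers_continuous_control[OF uc ub assms(1)] that by blast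
qed

text \<open>By separation, the points that can be steered are dense in \<open>reach\<close>. A
  convex set in finite dimension has the same interior as its closure, so interior points are
  steered exactly.\<close>

lemma interior_reach_imp_steers:
  assumes "x \<in> interior (reach \<theta>)" "0 \<le> \<theta>"
  shows "steers_to_zero A B x \<theta>"
proof -
  let ?S = "{x. steers_to_zero A B x \<theta>}"
  have "reach \<theta> \<subseteq> closure ?S"
  proof
    fix y assume y: "y \<in> reach \<theta>"
    show "y \<in> closure ?S"
    proof (rule ccontr)
      assume "y \<notin> closure ?S"
      then obtain a b where ab: "a \<bullet> y < b" "\<And>x. x \<in> closure ?S \<Longrightarrow> b < a \<bullet> x"
        using separating_hyperplane_closed_point[of "closure ?S" y] convex_closure[OF convex_steers] by auto
      obtain x where x: "steers_to_zero A B x \<theta>" "supp \<theta> (- a) - (b - a \<bullet> y) \<le> (- a) \<bullet> x"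
        using steers_near_support[OF assms(2), of "b - a \<bullet> y" "- a"] ab by auto
      have "b < a \<bullet> x" using x(1) closure_subset[of ?S] by (intro ab) auto
      moreover have "(- a) \<bullet> y \<le> supp \<theta> (- a)" using y unfolding reach_def by blast
      ultimately show False using x(2) by simp
    qed
  qed
  then have "interior (reach \<theta>) \<subseteq> interior (closure ?S)" by (rule interior_mono)
  also have "\<dots> = interior ?S" by (rule convex_interior_closure[OF convex_steers])
  finally show ?thesis using assms(1) interior_subset by blast
qed

end

section \<open>Normality: switching times and growth of the attainable sets\<close>

locale normal_system = linear_system A B for A :: "real^'n^'n" and B :: "real^'m^'n" +
  assumes normal: "dim (span {((*v) A ^^ k) (column j B) | k. k < CARD('n)}) = CARD('n)"
begin

text \<open>The derivatives of the switching function are, up to sign, the products of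
  \<open>z\<close> with \<open>exp (- s A)\<close> applied to the Krylov vectors of the column.
  These span the space, so all derivatives vanishing at one time would force
  \<open>z = 0\<close>.\<close>

lemma countable_switching_times:
  assumes "z \<noteq> 0"
  shows "countable {s. z \<bullet> input_dir j s = 0}"
proof -
  define F where "F k s = (- 1) ^ k * (z \<bullet> inv_flow s (((*v) A ^^ k) (column j B)))" for k s
  have "countable {s. F 0 s = 0}"
  proof (rule countable_zeros_of_derivative_chain)
    fix k s
    have "((\<lambda>s. z \<bullet> inv_flow s (((*v) A ^^ k) (column j B))) has_vector_derivative
        z \<bullet> - inv_flow s (A *v (((*v) A ^^ k) (column j B)))) (at s)"
      by (rule bounded_linear.has_vector_derivative[OF bounded_linear_inner_right inv_flow_apply_deriv])
    then have "((\<lambda>s. z \<bullet> inv_flow s (((*v) A ^^ k) (column j B))) has_real_derivative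
        - (z \<bullet> inv_flow s (((*v) A ^^ Suc k) (column j B)))) (at s)"
      by (simp add: has_real_derivative_iff_has_vector_derivative)
    from DERIV_cmult[OF this, of "(- 1) ^ k"] show "(F k has_real_derivative F (Suc k) s) (at s)"
      by (simp add: F_def[abs_def])
  next
    fix s
    show "\<exists>k. F k s \<noteq> 0"
    proof (rule ccontr)
      assume "\<nexists>k. F k s \<noteq> 0"
      then have zero: "z \<bullet> inv_flow s (((*v) A ^^ k) (column j B)) = 0" for k by (simp add: F_def)
      let ?S = "{((*v) A ^^ k) (column j B) | k. k < CARD('n)}"
      have lin: "linear (\<lambda>v. z \<bullet> inv_flow s v)"
        by (intro bounded_linear.linear bounded_linear_inner_right_comp blinfun.bounded_linear_right)
      have "span ?S = UNIV" using normal[of j] by (simp add: dim_eq_full[symmetric])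
      then have "z \<bullet> inv_flow s v = 0" for v
        using linear_eq_0_on_span[OF lin, of ?S v] zero by auto
      from this[of "inv_flow (- s) z"] have "z \<bullet> z = 0" by (simp add: inv_flow_def flow_back_inverse')
      with assms show False by simp
    qed
  qed
  then show ?thesis by (simp add: F_def input_dir_def)
qed

lemma input_dir_nonzero: "input_dir j s \<noteq> 0"
proof
  assume "input_dir j s = 0"
  then have "column j B = 0"
    using flow_back_inverse[of "Blinfun ((*v) A)" s "column j B"]
    by (simp add: input_dir_def inv_flow_def blinfun.zero_right)
  then have "{s. axis undefined 1 \<bullet> input_dir j s = 0} = UNIV"
    by (simp add: input_dir_def blinfun.zero_right)
  moreover have "axis undefined 1 \<noteq> (0 :: real^'n)" by (simp add: axis_eq_0_iff)
  ultimately show False using countable_switching_times[of "axis undefined 1" j] uncountable_UNIV_real by simp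
qed

lemma window_supp_pos:
  assumes "s < t" "z \<noteq> 0"
  shows "0 < integral {s..t} (\<lambda>r. \<Sum>j\<in>UNIV. \<bar>z \<bullet> input_dir j r\<bar>)" (is "0 < integral _ ?f")
proof -
  have "0 \<le> integral {s..t} ?f" by (intro integral_nonneg integrable_supp) (simp add: sum_nonneg)
  moreover have "integral {s..t} ?f \<noteq> 0"
  proof
    assume "integral {s..t} ?f = 0"
    then have "\<forall>r\<in>{s..t}. ?f r = 0"
      using assms by (subst (asm) integral_eq_0_iff) (auto intro!: continuous_intros sum_nonneg)
    then have "{s..t} \<subseteq> {r. z \<bullet> input_dir undefined r = 0}" by (auto simp: sum_nonneg_eq_0_iff)
    then show False
      using countable_subset[OF _ countable_switching_times[OF assms(2)]] uncountable_closed_interval[of s t] assms(1) by blast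
  qed
  ultimately show ?thesis by simp
qed

text \<open>The support function gains a positive amount in every direction over
  \<open>[s, t]\<close>; by compactness the gain is at least \<open>c * norm z\<close>, so a ball of
  radius \<open>c\<close> fits.\<close>

lemma reach_subset_interior:
  assumes "0 \<le> s" "s < t"
  shows "reach s \<subseteq> interior (reach t)"
proof -
  let ?f = "\<lambda>z. integral {s..t} (\<lambda>r. \<Sum>j\<in>UNIV. \<bar>z \<bullet> input_dir j r\<bar>)"
  obtain c where c: "0 < c" "\<And>z. c * norm z \<le> ?f z"
  proof (rule homogeneous_bound_below[of ?f])
    show "?f (c *\<^sub>R z) = c * ?f z" if "0 \<le> c" for c z using that unfolding scaled_dual_abs by simp
  qed (use continuous_on_window_supp window_supp_pos[OF assms(2)] in auto)
  show ?thesis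
  proof
    fix x assume x: "x \<in> reach s"
    have "ball x c \<subseteq> reach t"
    proof
      fix y assume y: "y \<in> ball x c"
      have "z \<bullet> y \<le> supp t z" for z
      proof -
        have "z \<bullet> y = z \<bullet> x + z \<bullet> (y - x)" by (simp add: inner_diff_right)
        also have "\<dots> \<le> supp s z + norm z * norm (y - x)"
          using x by (intro add_mono norm_cauchy_schwarz) (auto simp: reach_def)
        also have "\<dots> \<le> supp s z + norm z * c"
          using y by (intro add_left_mono mult_left_mono) (auto simp: dist_norm norm_minus_commute)
        also have "\<dots> \<le> supp t z" using c(2)[of z] supp_split[of s t z] assms by (simp add: mult.commute)
        finally show ?thesis .
      qed
      then show "y \<in> reach t" by (simp add: reach_def)
    qed
    then show "x \<in> interior (reach t)" using c(1) by (meson centre_in_ball interior_maximal open_ball subsetD)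
  qed
qed

section \<open>The minimum time function: sublevel sets and continuity\<close>

abbreviation "T \<equiv> min_time A B"

lemma min_time_nonneg: "0 \<le> T x"
  unfolding min_time_def by (auto intro!: Inf_greatest)

lemma T_le_if_steers: "0 \<le> \<theta> \<Longrightarrow> steers_to_zero A B x \<theta> \<Longrightarrow> T x \<le> ereal \<theta>"
  unfolding min_time_def by (auto intro!: Inf_lower)

lemma steers_if_T_less:
  assumes "T x < ereal t"
  obtains \<theta> where "0 \<le> \<theta>" "\<theta> < t" "steers_to_zero A B x \<theta>"
  using assms unfolding min_time_def Inf_less_iff by auto

text \<open>From right to left, a slightly larger horizon makes \<open>x\<close> an interior point,
  hence steerable. From left to right, \<open>x\<close> satisfies the support inequalities for every
  later horizon, and these pass to the limit by continuity in time.\<close>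

lemma T_le_iff:
  assumes "0 \<le> t"
  shows "T x \<le> ereal t \<longleftrightarrow> x \<in> reach t"
proof
  assume x: "x \<in> reach t"
  show "T x \<le> ereal t"
  proof (rule dense_ge)
    fix a assume "ereal t < a"
    then obtain r where r: "ereal t < ereal r" "ereal r < a" using ereal_dense2 by blast
    then have "x \<in> interior (reach r)" using reach_subset_interior[OF assms, of r] x by auto
    then have "T x \<le> ereal r" using r assms by (intro T_le_if_steers interior_reach_imp_steers) auto
    then show "T x \<le> a" using r by simp
  qed
next
  assume le: "T x \<le> ereal t"
  have step: "x \<in> reach t'" if "t < t'" for t'
  proof -
    have "T x < ereal t'" using le that by (meson ereal_less_eq(3) le_less_trans less_ereal.simps(1))
    then obtain \<theta> where "0 \<le> \<theta>" "\<theta> < t'" "steers_to_zero A B x \<theta>" by (rule steers_if_T_less)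
    then show ?thesis using steers_imp_reach reach_mono[of \<theta> t'] by auto
  qed
  obtain M where M: "0 < M" "\<And>s t' z. 0 \<le> s \<Longrightarrow> s \<le> t' \<Longrightarrow> t' \<le> t + 1 \<Longrightarrow> supp t' z \<le> supp s z + M * (t' - s) * norm z"
    using supp_increment_bound[of "t + 1"] assms by auto
  have "z \<bullet> x \<le> supp t z" for z
  proof (rule field_le_epsilon)
    fix e :: real assume "0 < e"
    \<comment> \<open>The 1 keeps the horizon in the range where \<open>M\<close> applies;
      \<open>norm z + 1\<close> avoids division by zero at \<open>z = 0\<close>.\<close>
    define h where "h = min 1 (e / (M * (norm z + 1)))"
    have den: "0 < M * (norm z + 1)" using M(1) by (simp add: add_nonneg_pos)
    have h: "0 < h" "h \<le> 1" "h * (M * (norm z + 1)) \<le> e"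
      using \<open>0 < e\<close> den by (auto simp: h_def min_def pos_le_divide_eq)
    have "z \<bullet> x \<le> supp (t + h) z" using step[of "t + h"] h by (auto simp: reach_def)
    also have "\<dots> \<le> supp t z + M * h * norm z" using M(2)[of t "t + h" z] assms h by simp
    also have "M * h * norm z \<le> h * (M * (norm z + 1))" using h M(1) by (simp add: algebra_simps)
    finally show "z \<bullet> x \<le> supp t z + e" using h by simp
  qed
  then show "x \<in> reach t" by (simp add: reach_def)
qed

lemma T_less_iff: "T x < ereal t \<longleftrightarrow> (\<exists>s. 0 \<le> s \<and> s < t \<and> x \<in> reach s)"
proof
  assume "T x < ereal t"
  then obtain s where s: "T x < ereal s" "ereal s < ereal t" using ereal_dense2 by blast
  then have "0 \<le> s" using min_time_nonneg[of x] by (metis ereal_less_eq(5) le_less_trans less_imp_le)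
  then show "\<exists>s. 0 \<le> s \<and> s < t \<and> x \<in> reach s" using s T_le_iff[of s x] by auto
next
  assume "\<exists>s. 0 \<le> s \<and> s < t \<and> x \<in> reach s"
  then obtain s where "0 \<le> s" "s < t" "T x \<le> ereal s" using T_le_iff by blast
  then show "T x < ereal t" by (meson le_less_trans less_ereal.simps(1))
qed

lemma open_T_less: "open {x. T x < ereal t}"
proof (subst open_subopen, intro ballI)
  fix x assume "x \<in> {x. T x < ereal t}"
  then obtain s where s: "0 \<le> s" "s < t" "x \<in> reach s" by (auto simp: T_less_iff)
  then have "x \<in> interior (reach ((s + t) / 2))" using reach_subset_interior[of s "(s + t) / 2"] by auto
  moreover have "interior (reach ((s + t) / 2)) \<subseteq> {x. T x < ereal t}"
  proof
    fix y assume "y \<in> interior (reach ((s + t) / 2))"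
    then have "y \<in> reach ((s + t) / 2)" using interior_subset by blast
    then show "y \<in> {x. T x < ereal t}" unfolding mem_Collect_eq T_less_iff using s by (intro exI[of _ "(s + t) / 2"]) auto
  qed
  ultimately show "\<exists>U. open U \<and> x \<in> U \<and> U \<subseteq> {x. T x < ereal t}" by (meson open_interior)
qed

lemma closed_T_le: "closed {x. T x \<le> ereal t}"
proof (cases "0 \<le> t")
  case True
  then show ?thesis using closed_reach T_le_iff[OF True] by simp
next
  case False
  then have "{x. T x \<le> ereal t} = {}" using min_time_nonneg by (auto dest: order_trans[OF min_time_nonneg])
  then show ?thesis by (metis closed_empty)
qed

lemma continuous_min_time: "continuous_on UNIV T"
proof (rule continuous_at_imp_continuous_on, rule ballI)
  fix x
  show "isCont T x" unfolding isCont_def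
  proof (rule order_tendstoI)
    fix a assume "a < T x"
    then obtain r where r: "a < ereal r" "ereal r < T x" using ereal_dense2 by blast
    have "open (- {x. T x \<le> ereal r})" using closed_T_le by blast
    then have "\<forall>\<^sub>F y in at x. y \<in> - {x. T x \<le> ereal r}"
      using r(2) by (intro topological_tendstoD[OF tendsto_ident_at]) auto
    then show "\<forall>\<^sub>F y in at x. a < T y" by (rule eventually_mono) (use r(1) in auto)
  next
    fix a assume "T x < a"
    then obtain r where r: "T x < ereal r" "ereal r < a" using ereal_dense2 by blast
    have "\<forall>\<^sub>F y in at x. y \<in> {x. T x < ereal r}"
      using r(1) by (intro topological_tendstoD[OF tendsto_ident_at] open_T_less) auto
    then show "\<forall>\<^sub>F y in at x. T y < a" by (rule eventually_mono) (use r(2) in auto)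
  qed
qed

lemma convex_T_less: "convex {x. T x < ereal t}"
proof (rule convexI)
  fix x y :: "real^'n" and a b :: real
  assume ab: "0 \<le> a" "0 \<le> b" "a + b = 1" and "x \<in> {x. T x < ereal t}" "y \<in> {x. T x < ereal t}"
  then obtain s1 s2 where s: "0 \<le> s1" "s1 < t" "x \<in> reach s1" "0 \<le> s2" "s2 < t" "y \<in> reach s2"
    by (auto simp: T_less_iff)
  then have "x \<in> reach (max s1 s2)" "y \<in> reach (max s1 s2)"
    using reach_mono[of s1 "max s1 s2"] reach_mono[of s2 "max s1 s2"] by auto
  then have "a *\<^sub>R x + b *\<^sub>R y \<in> reach (max s1 s2)" using convexD[OF convex_reach] ab by blast
  then show "a *\<^sub>R x + b *\<^sub>R y \<in> {x. T x < ereal t}"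
    unfolding mem_Collect_eq T_less_iff using s by (intro exI[of _ "max s1 s2"]) auto
qed

lemma bounded_T_less: "bounded {x. T x < ereal t}"
proof (rule bounded_subset[OF bounded_reach[of t]])
  show "{x. T x < ereal t} \<subseteq> reach t" unfolding T_less_iff using reach_mono[of _ t] by fastforce
qed

sublocale convex_sublevels T
  by unfold_locales (rule continuous_min_time min_time_nonneg convex_T_less bounded_T_less)+

text \<open>Compactness gives slack \<open>c * norm z\<close> in every support inequality.
  Shortening the horizon by \<open>h\<close> costs at most \<open>M * h * norm z\<close>, so a
  strictly shorter one still works.\<close>

lemma T_less_if_strict:
  assumes "0 < t" and strict: "\<And>z. z \<noteq> 0 \<Longrightarrow> z \<bullet> y < supp t z"
  shows "T y < ereal t"
proof -
  obtain c where c: "0 < c" "\<And>z. c * norm z \<le> supp t z - z \<bullet> y"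
  proof (rule homogeneous_bound_below[of "\<lambda>z. supp t z - z \<bullet> y"])
    show "continuous_on UNIV (\<lambda>z. supp t z - z \<bullet> y)"
      unfolding supp_def by (intro continuous_intros continuous_on_window_supp)
    show "supp t (c *\<^sub>R z) - (c *\<^sub>R z) \<bullet> y = c * (supp t z - z \<bullet> y)" if "0 \<le> c" for c z
      using that by (simp add: supp_scaleR right_diff_distrib)
  qed (use strict in auto)
  obtain M where M: "0 < M" "\<And>s t' z. 0 \<le> s \<Longrightarrow> s \<le> t' \<Longrightarrow> t' \<le> t \<Longrightarrow> supp t' z \<le> supp s z + M * (t' - s) * norm z"
    using supp_increment_bound[of t] assms by auto
  define h where "h = min t (c / M)"
  have h: "0 < h" "h \<le> t" "M * h \<le> c" using c(1) M(1) assms by (auto simp: h_def min_def field_simps)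
  have "z \<bullet> y \<le> supp (t - h) z" for z
  proof -
    have "supp t z \<le> supp (t - h) z + M * h * norm z" using M(2)[of "t - h" t z] h by simp
    moreover have "M * h * norm z \<le> c * norm z" using h by (intro mult_right_mono) auto
    ultimately show ?thesis using c(2)[of z] by simp
  qed
  then show ?thesis unfolding T_less_iff reach_def using h by (intro exI[of _ "t - h"]) auto
qed

section \<open>Differentiability of the support function, strict convexity and expansion\<close>

lemma supp_eq_lborel: "supp t z = (\<integral>s. indicator {0..t} s *\<^sub>R (\<Sum>j\<in>UNIV. \<bar>z \<bullet> input_dir j s\<bar>) \<partial>lborel)"
proof -
  have "set_integrable lborel {0..t} (\<lambda>s. \<Sum>j\<in>UNIV. \<bar>z \<bullet> input_dir j s\<bar>)"
    unfolding set_integrable_def by (intro borel_integrable_compact continuous_intros) auto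
  from set_borel_integral_eq_integral(2)[OF this] show ?thesis
    by (simp add: supp_def set_lebesgue_integral_def)
qed

text \<open>The switching times of each control component form a null set, so the support function is
  differentiable off the origin; therefore every supporting hyperplane touches at one point only.\<close>

lemma supp_directional_derivative:
  assumes "z \<noteq> 0"
  shows "\<exists>L. ((\<lambda>e. supp t (z + e *\<^sub>R y)) has_real_derivative L) (at 0)"
proof -
  let ?f = "\<lambda>e s. indicator {0..t} s *\<^sub>R (\<Sum>j\<in>UNIV. \<bar>(z + e *\<^sub>R y) \<bullet> input_dir j s\<bar>)"
  let ?g = "\<lambda>s. indicator {0..t} s *\<^sub>R (\<Sum>j\<in>UNIV. sgn (z \<bullet> input_dir j s) * (y \<bullet> input_dir j s))"
  let ?w = "\<lambda>s. indicator {0..t} s *\<^sub>R (\<Sum>j\<in>UNIV. \<bar>y \<bullet> input_dir j s\<bar>)"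
  have [measurable]: "input_dir j \<in> borel_measurable borel" for j
    by (intro borel_measurable_continuous_onI continuous_intros)
  have fint: "integrable lborel (?f e)" for e
    by (intro borel_integrable_compact continuous_intros) auto
  have AE: "AE s in lborel. \<forall>j. z \<bullet> input_dir j s \<noteq> 0"
  proof -
    have "AE s in lborel. z \<bullet> input_dir j s \<noteq> 0" for j
      using AE_not_in[OF countable_imp_null_set_lborel[OF countable_switching_times[OF assms, of j]]] by simp
    then show ?thesis by (simp add: AE_all_countable)
  qed
  have "((\<lambda>e. (supp t (z + e *\<^sub>R y) - supp t z) / e) \<longlongrightarrow> integral\<^sup>L lborel ?g) (at 0)"
    unfolding tendsto_at_iff_sequentially
  proof (intro allI impI)
    fix X :: "nat \<Rightarrow> real" assume X: "\<forall>i. X i \<in> UNIV - {0}" "X \<longlonglongrightarrow> 0"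
    let ?q = "\<lambda>i s. (?f (X i) s - ?f 0 s) / X i"
    have q_eq: "?q i s = indicator {0..t} s * (\<Sum>j\<in>UNIV. (\<bar>z \<bullet> input_dir j s + X i * (y \<bullet> input_dir j s)\<bar> - \<bar>z \<bullet> input_dir j s\<bar>) / X i)" for i s
      by (simp add: sum_divide_distrib[symmetric] sum_subtractf inner_add_left right_diff_distrib)
    have "(\<lambda>i. integral\<^sup>L lborel (?q i)) \<longlonglongrightarrow> integral\<^sup>L lborel ?g"
    proof (rule integral_dominated_convergence[where w="?w"])
      show "integrable lborel ?w" by (intro borel_integrable_compact continuous_intros) auto
      show "AE s in lborel. (\<lambda>i. ?q i s) \<longlonglongrightarrow> ?g s"
        using AE
      proof eventually_elim
        case (elim s)
        have "(\<lambda>i. (\<bar>a + X i * b\<bar> - \<bar>a\<bar>) / X i) \<longlonglongrightarrow> sgn a * b" if "a \<noteq> 0" for a b :: real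
        proof -
          have "(\<lambda>i. X i * b) \<longlonglongrightarrow> 0 * b" using X(2) by (intro tendsto_intros)
          then have "\<forall>\<^sub>F i in sequentially. \<bar>X i * b\<bar> < \<bar>a\<bar>"
            using that by (intro order_tendstoD(2)[OF tendsto_rabs_zero]) auto
          \<comment> \<open>Once the perturbation is smaller than the modulus of \<open>a\<close>,
            the sign no longer changes and the quotient equals its limit.\<close>
          then have "\<forall>\<^sub>F i in sequentially. (\<bar>a + X i * b\<bar> - \<bar>a\<bar>) / X i = sgn a * b"
          proof (rule eventually_mono)
            fix i assume "\<bar>X i * b\<bar> < \<bar>a\<bar>"
            then have "\<bar>a + X i * b\<bar> - \<bar>a\<bar> = sgn a * (X i * b)"
              using that by (cases "0 < a") auto
            then show "(\<bar>a + X i * b\<bar> - \<bar>a\<bar>) / X i = sgn a * b" using X(1) by simp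
          qed
          then show ?thesis by (rule tendsto_eventually)
        qed
        then show ?case unfolding q_eq using elim by (auto intro!: tendsto_intros)
      qed
      show "AE s in lborel. norm (?q i s) \<le> ?w s" for i
      proof (rule AE_I2)
        fix s
        have "\<bar>\<Sum>j\<in>UNIV. (\<bar>z \<bullet> input_dir j s + X i * (y \<bullet> input_dir j s)\<bar> - \<bar>z \<bullet> input_dir j s\<bar>) / X i\<bar>
            \<le> (\<Sum>j\<in>UNIV. \<bar>(\<bar>z \<bullet> input_dir j s + X i * (y \<bullet> input_dir j s)\<bar> - \<bar>z \<bullet> input_dir j s\<bar>) / X i\<bar>)" by (rule sum_abs)
        also have "\<dots> \<le> (\<Sum>j\<in>UNIV. \<bar>y \<bullet> input_dir j s\<bar>)"
        proof (rule sum_mono)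
          fix j
          have "\<bar>\<bar>z \<bullet> input_dir j s + X i * (y \<bullet> input_dir j s)\<bar> - \<bar>z \<bullet> input_dir j s\<bar>\<bar> \<le> \<bar>X i * (y \<bullet> input_dir j s)\<bar>" by linarith
          then show "\<bar>(\<bar>z \<bullet> input_dir j s + X i * (y \<bullet> input_dir j s)\<bar> - \<bar>z \<bullet> input_dir j s\<bar>) / X i\<bar> \<le> \<bar>y \<bullet> input_dir j s\<bar>"
            using X(1) by (simp add: abs_divide abs_mult divide_le_eq mult.commute)
        qed
        finally show "norm (?q i s) \<le> ?w s" unfolding q_eq by (simp add: abs_mult mult_left_mono)
      qed
    qed measurable
    moreover have "integral\<^sup>L lborel (?q i) = (supp t (z + X i *\<^sub>R y) - supp t z) / X i" for i
      using fint[of "X i"] fint[of 0] unfolding supp_eq_lborel by simp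
    ultimately show "((\<lambda>e. (supp t (z + e *\<^sub>R y) - supp t z) / e) \<circ> X) \<longlonglongrightarrow> integral\<^sup>L lborel ?g"
      by (simp only: o_def)
  qed
  then show ?thesis by (auto simp: has_field_derivative_iff)
qed

text \<open>If \<open>p\<close> attains the support value at \<open>z\<close>, then the support
  function minus the product with \<open>p\<close>, restricted to a line through \<open>z\<close>,
  has a minimum at \<open>z\<close>. Hence \<open>y \<bullet> p\<close> is the directional
  derivative along \<open>y\<close>, which determines \<open>p\<close>.\<close>

lemma support_point_unique:
  assumes z: "z \<noteq> 0" and p: "p \<in> reach t" "z \<bullet> p = supp t z" and q: "q \<in> reach t" "z \<bullet> q = supp t z"
  shows "p = q"
proof (rule vector_eq_ldot[THEN iffD1], intro allI)
  fix y :: "real^'n"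
  obtain L where L: "((\<lambda>e. supp t (z + e *\<^sub>R y)) has_real_derivative L) (at 0)"
    using supp_directional_derivative[OF z] by blast
  have "y \<bullet> p = L" if "p \<in> reach t" "z \<bullet> p = supp t z" for p
  proof -
    have "((\<lambda>e. supp t (z + e *\<^sub>R y) - (z + e *\<^sub>R y) \<bullet> p) has_real_derivative L - y \<bullet> p) (at 0)"
      using L by (auto intro!: derivative_eq_intros simp: inner_add_left)
    then have "L - y \<bullet> p = 0"
    proof (rule DERIV_local_min[of _ _ _ 1])
      show "\<forall>e. \<bar>0 - e\<bar> < 1 \<longrightarrow> supp t (z + 0 *\<^sub>R y) - (z + 0 *\<^sub>R y) \<bullet> p \<le> supp t (z + e *\<^sub>R y) - (z + e *\<^sub>R y) \<bullet> p"
        using that by (auto simp: reach_def)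
    qed simp
    then show ?thesis by simp
  qed
  then show "y \<bullet> p = y \<bullet> q" using p q by simp
qed

text \<open>Otherwise some nonzero \<open>z\<close> would attain the support value at the midpoint,
  and therefore at both \<open>p\<close> and \<open>q\<close>.\<close>

lemma T_midpoint_less:
  assumes "T p = ereal t" "T q = ereal t" "p \<noteq> q"
  shows "T (midpoint p q) < ereal t"
proof (rule ccontr)
  assume n: "\<not> T (midpoint p q) < ereal t"
  have "0 \<le> t" using assms(1) min_time_nonneg[of p] by simp
  then have pq: "p \<in> reach t" "q \<in> reach t" using T_le_iff[of t p] T_le_iff[of t q] assms(1,2) by simp_all
  \<comment> \<open>The strict criterion needs a positive horizon; at time 0 the set is the origin
    alone, which cannot contain two distinct points.\<close>
  have "t \<noteq> 0"
  proof
    assume "t = 0"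
    have "x = 0" if "x \<in> reach 0" for x
      using that unfolding reach_def by (metis (mono_tags, lifting) inner_gt_zero_iff mem_Collect_eq not_le supp_0)
    then show False using pq \<open>t = 0\<close> assms(3) by metis
  qed
  then have "0 < t" using \<open>0 \<le> t\<close> by simp
  then obtain z where z: "z \<noteq> 0" "supp t z \<le> z \<bullet> midpoint p q"
    using T_less_if_strict[of t "midpoint p q"] n by (meson not_le)
  have le: "z \<bullet> p \<le> supp t z" "z \<bullet> q \<le> supp t z" using pq by (auto simp: reach_def)
  have "z \<bullet> midpoint p q = (z \<bullet> p + z \<bullet> q) / 2" by (simp add: midpoint_def inner_add_right)
  then have ge: "2 * supp t z \<le> z \<bullet> p + z \<bullet> q" using z(2) by simp
  have "z \<bullet> p = supp t z" using le ge by linarith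
  moreover have "z \<bullet> q = supp t z" using le ge by linarith
  ultimately show False using support_point_unique[OF z(1) pq(1) _ pq(2)] assms(3) by blast
qed

text \<open>The extra time interval may be spent with component \<open>j\<close> held at a constant
  value 1 or -1. In dual form, the product of \<open>z\<close> with the resulting displacement is
  bounded by the increment of the support function.\<close>

lemma reach_diff_integral:
  assumes "x + \<sigma> *\<^sub>R integral {t..t + h} (input_dir j) \<in> reach t" "\<bar>\<sigma>\<bar> = 1" "0 \<le> t" "0 \<le> h"
  shows "x \<in> reach (t + h)"
proof -
  let ?w = "integral {t..t + h} (input_dir j)"
  have ci: "input_dir j integrable_on {t..t + h}" by (intro integrable_continuous_real continuous_intros)
  have "z \<bullet> x \<le> supp (t + h) z" for z
  proof -
    have "z \<bullet> ?w = integral {t..t + h} (\<lambda>s. z \<bullet> input_dir j s)"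
      using integral_linear[OF ci bounded_linear_inner_right, of z] by (simp add: o_def)
    also have "\<bar>\<dots>\<bar> \<le> integral {t..t + h} (\<lambda>s. \<Sum>j\<in>UNIV. \<bar>z \<bullet> input_dir j s\<bar>)"
    proof -
      have "norm (integral {t..t + h} (\<lambda>s. z \<bullet> input_dir j s)) \<le> integral {t..t + h} (\<lambda>s. \<Sum>j\<in>UNIV. \<bar>z \<bullet> input_dir j s\<bar>)"
      proof (rule Henstock_Kurzweil_Integration.integral_norm_bound_integral[OF _ integrable_supp])
        show "(\<lambda>s. z \<bullet> input_dir j s) integrable_on {t..t + h}" by (intro integrable_continuous_real continuous_intros)
        show "norm (z \<bullet> input_dir j s) \<le> (\<Sum>j\<in>UNIV. \<bar>z \<bullet> input_dir j s\<bar>)" for s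
          by (auto intro!: member_le_sum[of j UNIV "\<lambda>j. \<bar>z \<bullet> input_dir j s\<bar>"])
      qed
      then show ?thesis by simp
    qed
    finally have w: "\<bar>z \<bullet> ?w\<bar> \<le> supp (t + h) z - supp t z" using supp_split[of t "t + h" z] assms by simp
    have "z \<bullet> x = z \<bullet> (x + \<sigma> *\<^sub>R ?w) - \<sigma> * (z \<bullet> ?w)" by (simp add: inner_add_right)
    moreover have "z \<bullet> (x + \<sigma> *\<^sub>R ?w) \<le> supp t z" using assms(1) unfolding reach_def by blast
    moreover have "\<bar>\<sigma> * (z \<bullet> ?w)\<bar> = \<bar>z \<bullet> ?w\<bar>" using assms(2) by (simp add: abs_mult)
    ultimately show ?thesis using w by linarith
  qed
  then show ?thesis by (simp add: reach_def)
qed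

lemma integral_input_dir_approx:
  assumes "0 < e"
  obtains h0 where "0 < h0" "\<And>h. 0 < h \<Longrightarrow> h < h0 \<Longrightarrow> norm (integral {t..t + h} (input_dir j) - h *\<^sub>R input_dir j t) \<le> e * h"
proof -
  have "continuous_on UNIV (input_dir j)" by (intro continuous_intros)
  then obtain h0 where h0: "0 < h0" "\<And>s. dist s t < h0 \<Longrightarrow> dist (input_dir j s) (input_dir j t) < e"
    using assms unfolding continuous_on_iff by (metis UNIV_I)
  show ?thesis
  proof (rule that[OF h0(1)])
    fix h assume h: "0 < h" "h < h0"
    have ci: "input_dir j integrable_on {t..t + h}" by (intro integrable_continuous_real continuous_intros)
    have "integral {t..t + h} (input_dir j) - h *\<^sub>R input_dir j t = integral {t..t + h} (\<lambda>s. input_dir j s - input_dir j t)"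
      using h by (subst integral_diff[OF ci]) auto
    also have "norm \<dots> \<le> integral {t..t + h} (\<lambda>s. e)"
    proof (rule Henstock_Kurzweil_Integration.integral_norm_bound_integral)
      show "norm (input_dir j s - input_dir j t) \<le> e" if "s \<in> {t..t + h}" for s
        using h0(2)[of s] that h by (auto simp: dist_norm)
    qed (intro integrable_continuous_real continuous_intros)+
    finally show "norm (integral {t..t + h} (input_dir j) - h *\<^sub>R input_dir j t) \<le> e * h" using h by (simp add: mult.commute)
  qed
qed

text \<open>Let the line enter the sublevel set at \<open>p + d b\<close>, with a ball around that
  point inside. Shrinking towards \<open>p\<close> by the factor \<open>h / \<bar>d\<bar>\<close>
  puts into \<open>reach t\<close> a ball of radius proportional to \<open>h\<close> around the
  point at signed distance \<open>h\<close>, in units of \<open>b\<close>, from \<open>p\<close>.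
  The displacement available during the extra time \<open>h\<close> brings this ball back around
  \<open>p\<close>, up to an error of smaller order.\<close>

lemma T_expanding:
  assumes p: "T p = ereal t" and d: "T (p + d *\<^sub>R input_dir j t) < ereal t"
  shows "\<exists>r>0. \<exists>h0>0. \<forall>h q. 0 < h \<and> h < h0 \<and> norm (q - p) \<le> r * h \<longrightarrow> T q \<le> ereal (t + h)"
proof -
  have t: "0 \<le> t" using p min_time_nonneg[of p] by simp
  have d0: "d \<noteq> 0" using p d by auto
  have pr: "p \<in> reach t" using T_le_iff[OF t, of p] p by simp
  obtain \<rho> where \<rho>: "0 < \<rho>" "ball (p + d *\<^sub>R input_dir j t) \<rho> \<subseteq> {x. T x < ereal t}"
    using open_T_less[of t] d unfolding open_contains_ball by blast
  \<comment> \<open>One share \<open>r * h\<close> is for \<open>q - p\<close> and one for replacing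
    the integral of the moving direction by its value at \<open>t\<close>; rescaled by
    \<open>\<bar>d\<bar> / h\<close> they add up to \<open>\<rho> / 2\<close>.\<close>
  define r where "r = \<rho> / (4 * \<bar>d\<bar>)"
  have r: "0 < r" "\<bar>d\<bar> * r = \<rho> / 4" using \<rho>(1) d0 by (auto simp: r_def field_simps)
  obtain h0 where h0: "0 < h0" "\<And>h. 0 < h \<Longrightarrow> h < h0 \<Longrightarrow> norm (integral {t..t + h} (input_dir j) - h *\<^sub>R input_dir j t) \<le> r * h"
    using integral_input_dir_approx[OF r(1), of t j] by blast
  show ?thesis
  proof (rule exI[of _ r], rule conjI[OF r(1)], rule exI[of _ "min h0 \<bar>d\<bar>"], intro conjI allI impI)
    show "0 < min h0 \<bar>d\<bar>" using h0 d0 by simp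
    fix h q assume "0 < h \<and> h < min h0 \<bar>d\<bar> \<and> norm (q - p) \<le> r * h"
    then have h: "0 < h" "h < h0" "h < \<bar>d\<bar>" and q: "norm (q - p) \<le> r * h" by auto
    let ?w = "integral {t..t + h} (input_dir j)"
    define \<sigma> where "\<sigma> = sgn d"
    have \<sigma>: "\<bar>\<sigma>\<bar> = 1" "\<sigma> * \<bar>d\<bar> = d" using d0 by (auto simp: \<sigma>_def abs_sgn_eq sgn_mult_abs)
    define v where "v = (q - p) + \<sigma> *\<^sub>R (?w - h *\<^sub>R input_dir j t)"
    have "norm v \<le> norm (q - p) + norm (\<sigma> *\<^sub>R (?w - h *\<^sub>R input_dir j t))" unfolding v_def by (rule norm_triangle_ineq)
    also have "\<dots> \<le> r * h + r * h" using q h0(2)[OF h(1,2)] \<sigma> by (intro add_mono) auto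
    finally have v: "norm v \<le> 2 * r * h" by (simp add: mult_ac)
    define l where "l = h / \<bar>d\<bar>"
    have l: "0 < l" "l < 1" "l * \<bar>d\<bar> = h" using h d0 by (auto simp: l_def)
    \<comment> \<open>Chosen so that the convex combination of \<open>p\<close> and \<open>y\<close>
      with weight \<open>l\<close> is \<open>q\<close> moved by the displacement
      \<open>\<sigma>\<close> times \<open>?w\<close>.\<close>
    define y where "y = p + d *\<^sub>R input_dir j t + (1 / l) *\<^sub>R v"
    have "norm ((1 / l) *\<^sub>R v) \<le> (1 / l) * (2 * r * h)" using v l by (simp add: divide_right_mono)
    also have "\<dots> = 2 * (\<bar>d\<bar> * r)" using l(1,3) h by (simp add: field_simps)
    also have "\<dots> < \<rho>" using r \<rho>(1) by simp
    finally have "y \<in> ball (p + d *\<^sub>R input_dir j t) \<rho>" by (simp add: y_def dist_norm)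
    then have "T y \<le> ereal t" using \<rho>(2) by (auto intro: less_imp_le)
    then have "y \<in> reach t" using T_le_iff[OF t, of y] by simp
    then have "(1 - l) *\<^sub>R p + l *\<^sub>R y \<in> reach t" using pr l by (intro convexD[OF convex_reach]) auto
    also have "(1 - l) *\<^sub>R p + l *\<^sub>R y = p + (l * d) *\<^sub>R input_dir j t + v"
      using l(1) by (simp add: y_def algebra_simps)
    also have "l * d = \<sigma> * h" using \<sigma>(2) l(3) by (metis mult.assoc mult.commute)
    also have "p + (\<sigma> * h) *\<^sub>R input_dir j t + v = q + \<sigma> *\<^sub>R ?w" by (simp add: v_def algebra_simps)
    finally have "q \<in> reach (t + h)" using \<sigma> t h by (intro reach_diff_integral) auto
    then show "T q \<le> ereal (t + h)" using T_le_iff[of "t + h" q] t h by simp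
  qed
qed

text \<open>\<open>undefined\<close> stands for a fixed arbitrary column.\<close>

sublocale expanding_sublevels T "input_dir undefined"
proof
  show "continuous_on UNIV (input_dir undefined)" by (intro continuous_intros)
qed (rule input_dir_nonzero T_midpoint_less T_expanding; assumption?)+

end

theorem theorem6p5:
  fixes A :: "real^'n^'n" and B :: "real^'m^'n"
  assumes "CARD('m) \<le> CARD('n)"
    and "\<forall>i. dim (span {((*v) A ^^ k) (column i B) | k. k < CARD('n)}) = CARD('n)"
  shows "SBV_loc {x. min_time A B x < \<infinity>} (\<lambda>x. real_of_ereal (min_time A B x))"
proof -
  interpret normal_system A B using assms(2) by unfold_locales auto
  show ?thesis by (rule SBV_loc_T)
qed

end
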